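(* Let $I\subseteq\mathbb{R}$ be an interval, $G:I\to(0,1)$ a continuous strictly increasing bijection, and $X,X_1,X_2,\ldots$ i.i.d. with law $P$, $P(I)=1$. Put $U=G(X)$, fix an integer $q\ge1$, and let $\mathbf p_q=(p_1,\ldots,p_q)^\top$, $p_r=\mathbb{E}[U^r]$, and $\widehat{\mathbf p}_q=(\widehat p_1,\ldots,\widehat p_q)^\top$, $\widehat p_r=\frac1n\sum_{i=1}^nG(X_i)^r$. Given the data, let $X_1^*,\ldots,X_n^*$ be i.i.d. from the empirical distribution $\frac1n\sum_{i=1}^n\delta_{X_i}$ and let $\widehat{\mathbf p}_q^*$ have components $\widehat p_r^*=\frac1n\sum_{i=1}^nG(X_i^* )^r$. Then the bootstrap consistently estimates the joint law of $\sqrt n(\widehat{\mathbf p}_q-\mathbf p_q)$: the bounded-Lipschitz distance between the conditional law of $\sqrt n(\widehat{\mathbf p}_q^*-\widehat{\mathbf p}_q)$ given the data and the law of $\sqrt n(\widehat{\mathbf p}_q-\mathbf p_q)$ tends to $0$ in probability as $n\to\infty$. Moreover, in the same sense: (a) if $G'$ is continuous and positive at $M_r=G^{-1}(p_r)$ for $r=1,\ldots,q$, then the conditional law of $\sqrt n(\widehat{\mathbf M}_q^*-\widehat{\mathbf M}_q)$ consistently estimates the law of $\sqrt n(\widehat{\mathbf M}_q-\mathbf M_q)$, where $\mathbf M_q,\widehat{\mathbf M}_q,\widehat{\mathbf M}_q^*$ have components $G^{-1}(p_r),G^{-1}(\widehat p_r),G^{-1}(\widehat p_r^* )$; (b) for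 any finite selection of centred coordinate moments of orders between $2$ and $q$, with $h_q$ the corresponding polynomial map, the conditional law of $\sqrt n\{h_q(\widehat{\mathbf p}_q^* )-h_q(\widehat{\mathbf p}_q)\}$ consistently estimates the law of $\sqrt n\{h_q(\widehat{\mathbf p}_q)-h_q(\mathbf p_q)\}$.
   Context: The bounded-Lipschitz distance of laws $\mu,\nu$ on $\mathbb{R}^k$ is $\sup|\int h\,d\mu-\int h\,d\nu|$ over $h$ with $\|h\|_\infty\le1$ and Lipschitz constant at most $1$. "$G'$ continuous at a point" means $G$ is differentiable near the point with derivative continuous there. The centred coordinate moment of order $r\ge2$ is $\mu_{r,c}=\mathbb{E}[(U-p_1)^r]=\sum_{j=0}^r\binom rj(-p_1)^{r-j}p_j$ with $p_0=1$; $h_q$ maps $(p_1,\ldots,p_q)$ to the vector of the selected $\mu_{r,c}$ through this formula. *)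

theory Defs
  imports "HOL-Probability.Probability"
begin

definition BL_dist :: "(real ^ 'k) measure \<Rightarrow> (real ^ 'k) measure \<Rightarrow> real" where
  "BL_dist \<mu> \<nu> =
     (SUP h \<in> {h :: real ^ 'k \<Rightarrow> real. (\<forall>x. \<bar>h x\<bar> \<le> 1) \<and> 1-lipschitz_on UNIV h}.
        \<bar>(\<integral>x. h x \<partial>\<mu>) - (\<integral>x. h x \<partial>\<nu>)\<bar>)"

text \<open>Measurability is part of the definition, because \<^const>\<open>measure\<close> is 0 on
  non-measurable sets.\<close>

definition tendsto_zero_in_prob :: "'a measure \<Rightarrow> (nat \<Rightarrow> 'a \<Rightarrow> real) \<Rightarrow> bool" where
  "tendsto_zero_in_prob M D \<longleftrightarrow>
     (\<forall>n. D n \<in> borel_measurable M) \<and>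
     (\<forall>\<epsilon>>0. (\<lambda>n. measure M {\<omega> \<in> space M. \<bar>D n \<omega>\<bar> > \<epsilon>}) \<longlonglongrightarrow> 0)"

text \<open>The empirical distribution of \<open>x 0, \<dots>, x (n - 1)\<close>: each index carries mass \<open>1 / n\<close>,
  so repeated values accumulate mass. It is only meaningful for \<open>n > 0\<close>.\<close>

definition empirical :: "nat \<Rightarrow> (nat \<Rightarrow> real) \<Rightarrow> real measure" where
  "empirical n x = distr (measure_pmf (pmf_of_set {..<n})) borel x"

text \<open>A statistic is a function \<open>T\<close> of the sample size \<open>n\<close> and of a sequence \<open>x\<close>, of which only
  \<open>x 0, \<dots>, x (n - 1)\<close> matter.\<close>

definition error_law ::
  "'a measure \<Rightarrow> (nat \<Rightarrow> 'a \<Rightarrow> real) \<Rightarrow> (nat \<Rightarrow> (nat \<Rightarrow> real) \<Rightarrow> real ^ 'k) \<Rightarrow> real ^ 'k \<Rightarrow> nat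
     \<Rightarrow> (real ^ 'k) measure" where
  "error_law M X T \<theta> n = distr M borel (\<lambda>\<omega>. sqrt (real n) *\<^sub>R (T n (\<lambda>i. X i \<omega>) - \<theta>))"

text \<open>The conditional law given the data \<open>x\<close>: the bootstrap sample \<open>y\<close> is distributed according to
  the \<open>n\<close>-fold product of the empirical distribution of \<open>x\<close>.\<close>

definition bootstrap_law ::
  "(nat \<Rightarrow> (nat \<Rightarrow> real) \<Rightarrow> real ^ 'k) \<Rightarrow> nat \<Rightarrow> (nat \<Rightarrow> real) \<Rightarrow> (real ^ 'k) measure" where
  "bootstrap_law T n x =
     distr (\<Pi>\<^sub>M i\<in>{..<n}. empirical n x) borel (\<lambda>y. sqrt (real n) *\<^sub>R (T n y - T n x))"

definition bootstrap_consistent ::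
  "'a measure \<Rightarrow> (nat \<Rightarrow> 'a \<Rightarrow> real) \<Rightarrow> (nat \<Rightarrow> (nat \<Rightarrow> real) \<Rightarrow> real ^ 'k) \<Rightarrow> real ^ 'k \<Rightarrow> bool" where
  "bootstrap_consistent M X T \<theta> \<longleftrightarrow>
     tendsto_zero_in_prob M
       (\<lambda>n \<omega>. BL_dist (bootstrap_law T n (\<lambda>i. X i \<omega>)) (error_law M X T \<theta> n))"

text \<open>The observations lie in \<open>I\<close> only almost surely. Outside \<open>I\<close>, where \<open>G\<close> is not defined in the
  mathematical sense, the transform is set to 0, so that it is Borel measurable on the whole line.\<close>

definition transform :: "real set \<Rightarrow> (real \<Rightarrow> real) \<Rightarrow> real \<Rightarrow> real" where
  "transform I G x = (if x \<in> I then G x else 0)"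

definition moment :: "real measure \<Rightarrow> (real \<Rightarrow> real) \<Rightarrow> nat \<Rightarrow> real" where
  "moment P g r = (\<integral>x. g x ^ r \<partial>P)"

definition sample_moment :: "(real \<Rightarrow> real) \<Rightarrow> nat \<Rightarrow> (nat \<Rightarrow> real) \<Rightarrow> nat \<Rightarrow> real" where
  "sample_moment g n x r = (\<Sum>i<n. g (x i) ^ r) / real n"

text \<open>The coordinates of \<open>real ^ 'q\<close> are numbered \<open>1, \<dots>, q\<close> by a bijection
  \<open>ord\<close> from \<open>'q\<close> onto \<open>{1..q}\<close>.\<close>

definition moments :: "('q \<Rightarrow> nat) \<Rightarrow> real measure \<Rightarrow> (real \<Rightarrow> real) \<Rightarrow> real ^ 'q" where
  "moments ord P g = (\<chi> k. moment P g (ord k))"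

definition sample_moments ::
  "('q \<Rightarrow> nat) \<Rightarrow> (real \<Rightarrow> real) \<Rightarrow> nat \<Rightarrow> (nat \<Rightarrow> real) \<Rightarrow> real ^ 'q" where
  "sample_moments ord g n x = (\<chi> k. sample_moment g n x (ord k))"

definition quasi_means :: "real set \<Rightarrow> (real \<Rightarrow> real) \<Rightarrow> real ^ 'q \<Rightarrow> real ^ 'q" where
  "quasi_means I G p = (\<chi> k. inv_into I G (p $ k))"

definition coord :: "('q \<Rightarrow> nat) \<Rightarrow> real ^ 'q \<Rightarrow> nat \<Rightarrow> real" where
  "coord ord p j = (if j = 0 then 1 else p $ inv_into UNIV ord j)"

text \<open>The map \<open>h\<^sub>q\<close> for the selection of centred moments with orders \<open>s i\<close>.\<close>

definition centred_moments :: "('q \<Rightarrow> nat) \<Rightarrow> ('m \<Rightarrow> nat) \<Rightarrow> real ^ 'q \<Rightarrow> real ^ 'm" where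
  "centred_moments ord s p =
     (\<chi> i. \<Sum>j\<le>s i. real (s i choose j) * (- coord ord p 1) ^ (s i - j) * coord ord p j)"

lemma centred_moments_eq_expectation:
  fixes ord :: "'q::finite \<Rightarrow> nat" and s :: "'m::finite \<Rightarrow> nat"
  assumes "prob_space P" "g \<in> borel_measurable P" "\<And>x. 0 \<le> g x" "\<And>x. g x \<le> 1"
    and ord: "bij_betw ord UNIV {1..q}" and s: "2 \<le> s i" "s i \<le> q"
  shows "centred_moments ord s (moments ord P g) $ i = (\<integral>x. (g x - moment P g 1) ^ s i \<partial>P)"
proof -
  interpret prob_space P by fact
  have int: "integrable P (\<lambda>x. g x ^ j)" for j
    by (rule integrable_const_bound[where B = 1])
      (use assms in \<open>auto simp: power_le_one\<close>)
  have c: "coord ord (moments ord P g) j = moment P g j" if "j \<le> q" for j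
  proof (cases "j = 0")
    case True
    then show ?thesis by (simp add: coord_def moment_def prob_space)
  next
    case False
    then have "j \<in> range ord" using ord that by (auto simp: bij_betw_def)
    then show ?thesis using False by (simp add: coord_def moments_def f_inv_into_f)
  qed
  have "(\<integral>x. (g x - moment P g 1) ^ s i \<partial>P) =
      (\<integral>x. (\<Sum>j\<le>s i. (real (s i choose j) * (- moment P g 1) ^ (s i - j)) * g x ^ j) \<partial>P)"
    by (intro Bochner_Integration.integral_cong refl)
      (subst diff_conv_add_uminus, subst binomial_ring, simp add: mult_ac)
  also have "\<dots> = (\<Sum>j\<le>s i. (real (s i choose j) * (- moment P g 1) ^ (s i - j)) * moment P g j)"
    by (subst Bochner_Integration.integral_sum) (use int in \<open>auto simp: moment_def\<close>)
  also have "\<dots> = centred_moments ord s (moments ord P g) $ i"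
    using s by (auto simp: centred_moments_def c intro!: sum.cong)
  finally show ?thesis by simp
qed

definition C1_near :: "(real \<Rightarrow> real) \<Rightarrow> real \<Rightarrow> bool" where
  "C1_near G m \<longleftrightarrow> (\<forall>\<^sub>F x in nhds m. G differentiable (at x)) \<and> isCont (deriv G) m"

end

theory Submission
  imports Defs
begin

text \<open>No central limit theorem is needed: the bootstrap law and the true law are compared directly
  by coupling (Bickel and Freedman). Couple the empirical law of the \<open>U\<^sub>i\<close> with the law of \<open>U\<close> by their
  quantile functions; then \<open>E \<bar>U\<^sup>* - U\<bar>\<close> is the integral of the distance \<open>W\<close> between the two distribution
  functions over \<open>[0, 1]\<close>, whose mean is at most \<open>2 / sqrt n\<close>. In a product of \<open>n\<close> copies of this coupling
  the centred sums \<open>Z\<^sup>*\<close> and \<open>Z\<close> of the vectors of powers satisfy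
  \<open>E (norm (Z\<^sup>* - Z))\<^sup>2 \<le> \<kappa>\<^sup>2 W\<close>, because variances of independent summands add up and the
  powers are Lipschitz on \<open>[0, 1]\<close>. A map with a strict derivative at the moment vector carries this
  over to its values, which covers the identity, the quasi-means and the centred moments at once.\<close>

subsection \<open>Averages of independent bounded vectors\<close>

text \<open>With no limit law at hand, the map has to be linearised under both laws at finite n. The
  true statistic is centred at the fixed moment vector, the bootstrap statistic at the sample
  moments, which move with the data. An ordinary derivative at the moment vector controls only
  increments from that one point; a strict derivative controls increments between any two points
  near it.

  This control is local. Test functions are bounded by 1, so distances may be cut at 2, and
  Chebyshev pays for the event that an average leaves the neighbourhood.

  W is an area between distribution functions rather than their uniform distance, so a mean bound at
  each fixed t suffices and Tonelli does the rest. On [0, 1] a squared distance is at most the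
  distance, which is why the first-order quantity W controls second moments.

  A separate obstacle is measurability: convergence in probability includes that of a supremum over
  an uncountable class of test functions. Resampling indices instead of values turns each bootstrap
  expectation into a finite sum whose weights do not depend on the data.\<close>

lemma norm_sq_eq_sum_Basis:
  fixes x :: "'b::euclidean_space"
  shows "(norm x)\<^sup>2 = (\<Sum>b\<in>Basis. (x \<bullet> b)\<^sup>2)"
  by (subst power2_norm_eq_inner, subst euclidean_inner) (simp only: power2_eq_square)

text \<open>Bienayme's identity: after expanding the square, independence factorises each
  off-diagonal expectation into two zero means. The bound \<open>C\<close> supplies the
  integrability.\<close>

lemma (in prob_space) expectation_sum_square_indep:
  fixes Y :: "'i \<Rightarrow> 'a \<Rightarrow> real"
  assumes "finite J" and indep: "indep_vars (\<lambda>_. borel) Y J"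
    and bounded: "\<And>i \<omega>. i \<in> J \<Longrightarrow> \<omega> \<in> space M \<Longrightarrow> \<bar>Y i \<omega>\<bar> \<le> C"
    and centred: "\<And>i. i \<in> J \<Longrightarrow> expectation (Y i) = 0"
  shows "expectation (\<lambda>\<omega>. (\<Sum>i\<in>J. Y i \<omega>)\<^sup>2) = (\<Sum>i\<in>J. expectation (\<lambda>\<omega>. (Y i \<omega>)\<^sup>2))"
proof -
  have meas[measurable]: "Y i \<in> borel_measurable M" if "i \<in> J" for i
    using indep that by (auto simp: indep_vars_def)
  have int: "integrable M (Y i)" if "i \<in> J" for i
    using bounded that by (intro integrable_const_bound[where B = C]) auto
  have int2: "integrable M (\<lambda>\<omega>. Y i \<omega> * Y j \<omega>)" if "i \<in> J" "j \<in> J" for i j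
    using that abs_ge_zero[of "Y _ _"]
    by (intro integrable_const_bound[where B = "C * C"])
      (auto simp: abs_mult intro!: mult_mono bounded order_trans[OF abs_ge_zero bounded])
  have cross: "expectation (\<lambda>\<omega>. Y i \<omega> * Y j \<omega>) = (if i = j then expectation (\<lambda>\<omega>. (Y i \<omega>)\<^sup>2) else 0)"
    if "i \<in> J" "j \<in> J" for i j
  proof (cases "i = j")
    case False
    have "indep_vars (\<lambda>_. borel) Y {i, j}"
      using indep by (rule indep_vars_subset) (use that in auto)
    from indep_vars_lebesgue_integral[OF _ this] that False int show ?thesis
      by (auto simp: centred)
  qed (simp add: power2_eq_square)
  have "expectation (\<lambda>\<omega>. (\<Sum>i\<in>J. Y i \<omega>)\<^sup>2) = expectation (\<lambda>\<omega>. \<Sum>i\<in>J. \<Sum>j\<in>J. Y i \<omega> * Y j \<omega>)"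
    by (simp add: power2_eq_square sum_product)
  also have "\<dots> = (\<Sum>i\<in>J. \<Sum>j\<in>J. expectation (\<lambda>\<omega>. Y i \<omega> * Y j \<omega>))"
    by (subst Bochner_Integration.integral_sum, (auto intro!: int2 Bochner_Integration.integrable_sum)[1])
      (intro sum.cong refl Bochner_Integration.integral_sum int2)
  also have "\<dots> = (\<Sum>i\<in>J. expectation (\<lambda>\<omega>. (Y i \<omega>)\<^sup>2))"
    using \<open>finite J\<close> by (intro sum.cong refl) (simp add: cross)
  finally show ?thesis .
qed

lemma (in prob_space) integrable_bounded:
  fixes f :: "'a \<Rightarrow> 'b::euclidean_space"
  assumes "f \<in> borel_measurable M" "\<And>\<omega>. \<omega> \<in> space M \<Longrightarrow> norm (f \<omega>) \<le> C"
  shows "integrable M f"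
  using assms by (intro integrable_const_bound[where B = C]) auto

text \<open>Coordinatewise, variances of independent summands add up, and a variance is at most the
  raw second moment. The factor \<open>sqrt n\<close> makes the result free of \<open>n\<close>.
  With raw second moments as \<open>D\<close>, a difference of coupled vectors can be inserted
  without knowing its mean.\<close>

lemma (in prob_space) expectation_sq_norm_average_le:
  fixes V :: "nat \<Rightarrow> 'a \<Rightarrow> 'b::euclidean_space"
  assumes "0 < n" and indep: "indep_vars (\<lambda>_. borel) V {..<n}"
    and bounded: "\<And>i \<omega>. i < n \<Longrightarrow> \<omega> \<in> space M \<Longrightarrow> norm (V i \<omega>) \<le> C"
    and mean: "\<And>i. i < n \<Longrightarrow> expectation (V i) = m"
    and second: "\<And>i. i < n \<Longrightarrow> expectation (\<lambda>\<omega>. (norm (V i \<omega>))\<^sup>2) \<le> D"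
  shows "integrable M (\<lambda>\<omega>. (norm (sqrt n *\<^sub>R ((\<Sum>i<n. V i \<omega>) /\<^sub>R n - m)))\<^sup>2)" (is ?int)
    and "expectation (\<lambda>\<omega>. (norm (sqrt n *\<^sub>R ((\<Sum>i<n. V i \<omega>) /\<^sub>R n - m)))\<^sup>2) \<le> D" (is ?le)
proof -
  have meas[measurable]: "V i \<in> borel_measurable M" if "i < n" for i
    using indep that by (auto simp: indep_vars_def)
  have int: "integrable M (V i)" if "i < n" for i
    using bounded that by (intro integrable_bounded[where C = C]) auto
  have C: "0 \<le> C"
    using bounded[OF \<open>0 < n\<close>] not_empty by (meson ex_in_conv norm_ge_zero order_trans)
  have m: "norm m \<le> C"
  proof -
    have "norm m \<le> expectation (\<lambda>\<omega>. norm (V 0 \<omega>))"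
      using mean[OF \<open>0 < n\<close>] by (metis integral_norm_bound)
    also have "\<dots> \<le> expectation (\<lambda>\<omega>. C)"
      using \<open>0 < n\<close> by (intro integral_mono integrable_norm int bounded) auto
    finally show ?thesis by (simp add: prob_space)
  qed
  define Y where "Y b i \<omega> = (V i \<omega> - m) \<bullet> b" for b i \<omega>
  have Y_meas[measurable]: "Y b i \<in> borel_measurable M" if "i < n" for b i
    using that unfolding Y_def by simp
  have Y_bound: "\<bar>Y b i \<omega>\<bar> \<le> 2 * C" if "b \<in> Basis" "i < n" "\<omega> \<in> space M" for b i \<omega>
  proof -
    have "\<bar>Y b i \<omega>\<bar> \<le> norm (V i \<omega> - m)"
      unfolding Y_def by (rule Basis_le_norm[OF that(1)])
    also have "\<dots> \<le> 2 * C"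
      using norm_triangle_ineq4[of "V i \<omega>" m] bounded[OF that(2,3)] m by simp
    finally show ?thesis .
  qed
  have Y_indep: "indep_vars (\<lambda>_. borel) (Y b) {..<n}" for b
    unfolding Y_def[abs_def] by (rule indep_vars_compose2[OF indep]) auto
  have Y_mean: "expectation (Y b i) = 0" if "i < n" for b i
    unfolding Y_def using int[OF that] mean[OF that]
    by (subst integral_inner_left) (auto simp: prob_space)
  have Y_sq: "expectation (\<lambda>\<omega>. (Y b i \<omega>)\<^sup>2) \<le> expectation (\<lambda>\<omega>. (V i \<omega> \<bullet> b)\<^sup>2)" if "b \<in> Basis" "i < n" for b i
  proof -
    have i1: "integrable M (\<lambda>\<omega>. V i \<omega> \<bullet> b)"
      using int[OF that(2)] by simp
    have i2: "integrable M (\<lambda>\<omega>. (V i \<omega> \<bullet> b)\<^sup>2)"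
      using that order_trans[OF Basis_le_norm[OF that(1)] bounded[OF that(2)]] C
      by (intro integrable_bounded[where C = "C\<^sup>2"]) (auto simp: abs_le_square_iff[symmetric])
    have "expectation (\<lambda>\<omega>. V i \<omega> \<bullet> b) = m \<bullet> b"
      using int[OF that(2)] mean[OF that(2)] by (subst integral_inner_left) auto
    with variance_eq[OF i1 i2] show ?thesis
      by (simp add: Y_def inner_diff_left)
  qed
  \<comment> \<open>In each coordinate \<open>sqrt n\<close> against the division by
    \<open>n\<close> leaves \<open>1 / sqrt n\<close>; squaring gives the factor
    \<open>1 / n\<close> that later cancels the \<open>n\<close> summands.\<close>
  have eq: "(norm (sqrt n *\<^sub>R ((\<Sum>i<n. V i \<omega>) /\<^sub>R n - m)))\<^sup>2 = (\<Sum>b\<in>Basis. (\<Sum>i<n. Y b i \<omega>)\<^sup>2) / n" for \<omega>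
  proof -
    have "(sqrt n *\<^sub>R ((\<Sum>i<n. V i \<omega>) /\<^sub>R n - m)) \<bullet> b = (\<Sum>i<n. Y b i \<omega>) / sqrt n" for b
    proof -
      have "(\<Sum>i<n. Y b i \<omega>) = (\<Sum>i<n. V i \<omega>) \<bullet> b - n * (m \<bullet> b)"
        by (simp add: Y_def inner_diff_left sum_subtractf inner_sum_left)
      also have "\<dots> = sqrt n * (sqrt n * ((\<Sum>i<n. V i \<omega>) \<bullet> b / n - m \<bullet> b))"
        using \<open>0 < n\<close> by (simp add: right_diff_distrib flip: mult.assoc)
      finally show ?thesis
        using \<open>0 < n\<close> by (simp add: inner_diff_left divide_inverse mult.commute)
    qed
    then show ?thesis
      unfolding norm_sq_eq_sum_Basis by (simp only: power_divide sum_divide_distrib[of _ Basis]) simp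
  qed
  have sum_int: "integrable M (\<lambda>\<omega>. (\<Sum>i<n. Y b i \<omega>)\<^sup>2)" if "b \<in> Basis" for b
  proof (rule integrable_bounded)
    show "norm ((\<Sum>i<n. Y b i \<omega>)\<^sup>2) \<le> (n * (2 * C))\<^sup>2" if "\<omega> \<in> space M" for \<omega>
    proof -
      have "\<bar>\<Sum>i<n. Y b i \<omega>\<bar> \<le> (\<Sum>i<n. \<bar>Y b i \<omega>\<bar>)" by (rule sum_abs)
      also have "\<dots> \<le> (\<Sum>i<n. 2 * C)"
        using that \<open>b \<in> Basis\<close> by (intro sum_mono Y_bound) auto
      finally have "\<bar>\<Sum>i<n. Y b i \<omega>\<bar>\<^sup>2 \<le> (n * (2 * C))\<^sup>2"
        by (intro power_mono) auto
      then show ?thesis by simp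
    qed
  qed simp
  show ?int
    unfolding eq by (intro integrable_divide Bochner_Integration.integrable_sum sum_int)
  have "expectation (\<lambda>\<omega>. (norm (sqrt n *\<^sub>R ((\<Sum>i<n. V i \<omega>) /\<^sub>R n - m)))\<^sup>2)
      = (\<Sum>b\<in>Basis. expectation (\<lambda>\<omega>. (\<Sum>i<n. Y b i \<omega>)\<^sup>2)) / n"
    unfolding eq by (simp add: sum_int)
  also have "\<dots> = (\<Sum>b\<in>Basis. \<Sum>i<n. expectation (\<lambda>\<omega>. (Y b i \<omega>)\<^sup>2)) / n"
    using Y_bound Y_mean Y_indep
    by (intro arg_cong2[where f = "(/)"] sum.cong refl expectation_sum_square_indep[where C = "2 * C"]) auto
  also have "\<dots> \<le> (\<Sum>b\<in>Basis. \<Sum>i<n. expectation (\<lambda>\<omega>. (V i \<omega> \<bullet> b)\<^sup>2)) / n"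
    by (intro divide_right_mono sum_mono Y_sq) auto
  also have "\<dots> = (\<Sum>i<n. expectation (\<lambda>\<omega>. (norm (V i \<omega>))\<^sup>2)) / n"
  proof -
    have "integrable M (\<lambda>\<omega>. (V i \<omega> \<bullet> b)\<^sup>2)" if "b \<in> Basis" "i < n" for b i
      using that order_trans[OF Basis_le_norm[OF that(1)] bounded[OF that(2)]] C
      by (intro integrable_bounded[where C = "C\<^sup>2"]) (auto simp: abs_le_square_iff[symmetric])
    then show ?thesis
      by (subst sum.swap) (simp add: norm_sq_eq_sum_Basis)
  qed
  also have "\<dots> \<le> (\<Sum>i<n. D) / n"
    by (intro divide_right_mono sum_mono second) auto
  finally show ?le
    using \<open>0 < n\<close> by simp
qed

text \<open>Independence means that the joint law is the product of the marginal laws. The joint map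
  is restriction to \<open>J\<close>, which is the identity because points of the product space are
  extensional.\<close>

lemma indep_vars_PiM_coordinates:
  assumes "prob_space K" "finite J" "J \<noteq> {}"
  shows "prob_space.indep_vars (\<Pi>\<^sub>M i\<in>J. K) (\<lambda>_. K) (\<lambda>i \<omega>. \<omega> i) J"
proof -
  interpret K: prob_space K by fact
  interpret P: prob_space "\<Pi>\<^sub>M i\<in>J. K" using K.prob_space_axioms by (rule prob_space_PiM)
    have "distr (\<Pi>\<^sub>M i\<in>J. K) (\<Pi>\<^sub>M i\<in>J. K) (\<lambda>x. restrict x J) = distr (\<Pi>\<^sub>M i\<in>J. K) (\<Pi>\<^sub>M i\<in>J. K) (\<lambda>x. x)"
      by (intro distr_cong refl) (auto simp: space_PiM extensional_restrict PiE_def)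
    moreover have "(\<Pi>\<^sub>M i\<in>J. distr (\<Pi>\<^sub>M i\<in>J. K) K (\<lambda>\<omega>. \<omega> i)) = (\<Pi>\<^sub>M i\<in>J. K)"
      using assms by (intro PiM_cong refl) (subst distr_PiM_component, auto)
    ultimately show ?thesis
      using \<open>J \<noteq> {}\<close> by (subst P.indep_vars_iff_distr_eq_PiM') (auto simp: distr_id2)
qed

section \<open>Couplings and the bounded-Lipschitz distance\<close>

text \<open>A test function oscillates by at most 2 and moves by at most the distance of its
  arguments. The majorant \<open>b\<close> is left free so that it can be built from squared norms,
  whose expectations are under control.\<close>

lemma BL_dist_coupling_le:
  fixes f f' :: "'a \<Rightarrow> real ^ 'k::finite"
  assumes "prob_space N" and [measurable]: "f \<in> borel_measurable N" "f' \<in> borel_measurable N"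
    and b: "integrable N b" "\<And>\<omega>. \<omega> \<in> space N \<Longrightarrow> min 2 (norm (f \<omega> - f' \<omega>)) \<le> b \<omega>"
  shows "BL_dist (distr N borel f) (distr N borel f') \<le> (\<integral>\<omega>. b \<omega> \<partial>N)"
  unfolding BL_dist_def
proof (rule cSUP_least)
  show "{h :: real ^ 'k \<Rightarrow> real. (\<forall>x. \<bar>h x\<bar> \<le> 1) \<and> 1-lipschitz_on UNIV h} \<noteq> {}"
    by (auto intro!: exI[of _ "\<lambda>_. 0"] simp: lipschitz_on_def)
  interpret N: prob_space N by fact
  fix h :: "real ^ 'k \<Rightarrow> real"
  assume h: "h \<in> {h. (\<forall>x. \<bar>h x\<bar> \<le> 1) \<and> 1-lipschitz_on UNIV h}"
  then have "continuous_on UNIV h" by (auto intro: lipschitz_on_continuous_on)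
  then have [measurable]: "h \<in> borel_measurable borel" by (rule borel_measurable_continuous_onI)
  have int: "integrable N (\<lambda>\<omega>. h (f \<omega>))" "integrable N (\<lambda>\<omega>. h (f' \<omega>))"
    using h by (auto intro!: N.integrable_bounded[where C = 1])
  have le: "\<bar>h (f \<omega>) - h (f' \<omega>)\<bar> \<le> b \<omega>" if "\<omega> \<in> space N" for \<omega>
  proof -
    have "\<bar>h (f \<omega>) - h (f' \<omega>)\<bar> \<le> 2"
    proof -
      have "\<bar>h (f \<omega>)\<bar> \<le> 1" "\<bar>h (f' \<omega>)\<bar> \<le> 1" using h by blast+
      then show ?thesis by linarith
    qed
    moreover have "\<bar>h (f \<omega>) - h (f' \<omega>)\<bar> \<le> norm (f \<omega> - f' \<omega>)"
      using h lipschitz_onD[of 1 UNIV h "f \<omega>" "f' \<omega>"] by (auto simp: dist_norm)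
    ultimately show ?thesis using b(2)[OF that] by linarith
  qed
  have "\<bar>(\<integral>x. h x \<partial>distr N borel f) - (\<integral>x. h x \<partial>distr N borel f')\<bar> = \<bar>\<integral>\<omega>. h (f \<omega>) - h (f' \<omega>) \<partial>N\<bar>"
    using int by (simp add: integral_distr)
  also have "\<dots> \<le> (\<integral>\<omega>. \<bar>h (f \<omega>) - h (f' \<omega>)\<bar> \<partial>N)"
    by (rule integral_abs_bound)
  also have "\<dots> \<le> (\<integral>\<omega>. b \<omega> \<partial>N)"
    using int b(1) by (intro integral_mono le) auto
  finally show "\<bar>(\<integral>x. h x \<partial>distr N borel f) - (\<integral>x. h x \<partial>distr N borel f')\<bar> \<le> (\<integral>\<omega>. b \<omega> \<partial>N)" .
qed

text \<open>Trades a norm for a squared norm, so that second moments suffice throughout. The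
  parameter \<open>c\<close> is later 1 or a small number \<eta>.\<close>

lemma le_add_sq_divide:
  fixes t :: real
  assumes "0 < c"
  shows "t \<le> c + t\<^sup>2 / c"
proof -
  \<comment> \<open>The right-hand side is the expansion of
    \<open>t\<^sup>2 - t * c + c\<^sup>2\<close>, the claim multiplied by \<open>c\<close>.\<close>
  have "0 \<le> (t - c / 2)\<^sup>2 + 3 / 4 * c\<^sup>2"
    by simp
  then have "t * c \<le> (c + t\<^sup>2 / c) * c"
    using assms by (simp add: power2_eq_square algebra_simps)
  with assms show ?thesis by simp
qed

lemma expectation_sq_norm_average_PiM_le:
  fixes v :: "'a \<Rightarrow> 'b::euclidean_space" and n :: nat
  assumes "prob_space K" and n: "0 < n" and [measurable]: "v \<in> borel_measurable K"
    and bounded: "\<And>\<omega>. \<omega> \<in> space K \<Longrightarrow> norm (v \<omega>) \<le> C"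
  defines "Z \<equiv> \<lambda>\<omega>. sqrt n *\<^sub>R ((\<Sum>i<n. v (\<omega> i)) /\<^sub>R n - (\<integral>\<omega>. v \<omega> \<partial>K))"
  shows "integrable (\<Pi>\<^sub>M i\<in>{..<n}. K) (\<lambda>\<omega>. (norm (Z \<omega>))\<^sup>2)"
    and "(\<integral>\<omega>. (norm (Z \<omega>))\<^sup>2 \<partial>(\<Pi>\<^sub>M i\<in>{..<n}. K)) \<le> (\<integral>\<omega>. (norm (v \<omega>))\<^sup>2 \<partial>K)"
proof -
  interpret K: prob_space K by fact
  interpret P: prob_space "\<Pi>\<^sub>M i\<in>{..<n}. K" using K.prob_space_axioms by (rule prob_space_PiM)
  have indep: "P.indep_vars (\<lambda>_. borel) (\<lambda>i \<omega>. v (\<omega> i)) {..<n}"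
    by (rule P.indep_vars_compose2[OF indep_vars_PiM_coordinates]) (use K.prob_space_axioms n in auto)
  have bd: "norm (v (\<omega> i)) \<le> C" if "i < n" "\<omega> \<in> space (\<Pi>\<^sub>M i\<in>{..<n}. K)" for i \<omega>
    using that by (intro bounded) (auto simp: space_PiM)
  have int: "(\<integral>\<omega>. v (\<omega> i) \<partial>(\<Pi>\<^sub>M i\<in>{..<n}. K)) = (\<integral>\<omega>. v \<omega> \<partial>K)"
    "(\<integral>\<omega>. (norm (v (\<omega> i)))\<^sup>2 \<partial>(\<Pi>\<^sub>M i\<in>{..<n}. K)) = (\<integral>\<omega>. (norm (v \<omega>))\<^sup>2 \<partial>K)" if "i < n" for i
    using that K.prob_space_axioms
    by (subst (2) distr_PiM_component[where I = "{..<n}" and M = "\<lambda>_. K" and i = i, symmetric];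
        auto simp: integral_distr)+
  note le = P.expectation_sq_norm_average_le[where V = "\<lambda>i \<omega>. v (\<omega> i)" and n = n and C = C
      and D = "\<integral>\<omega>. (norm (v \<omega>))\<^sup>2 \<partial>K" and m = "\<integral>\<omega>. v \<omega> \<partial>K", OF n indep]
  show "integrable (\<Pi>\<^sub>M i\<in>{..<n}. K) (\<lambda>\<omega>. (norm (Z \<omega>))\<^sup>2)"
    unfolding Z_def by (rule le(1)) (simp_all add: int bd)
  show "(\<integral>\<omega>. (norm (Z \<omega>))\<^sup>2 \<partial>(\<Pi>\<^sub>M i\<in>{..<n}. K)) \<le> (\<integral>\<omega>. (norm (v \<omega>))\<^sup>2 \<partial>K)"
    unfolding Z_def by (rule le(2)) (simp_all add: int bd)
qed

text \<open>The quantitative delta method. The three terms of the bound are Chebyshev's price for an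
  average leaving the ball, the linearisation errors of the two statistics, and the linear image of
  the difference of the two centred sums. Because \<open>a\<close> and \<open>b\<close> live on the
  same space, that difference is itself the centred sum of \<open>a - b\<close>, so only the second
  moment of \<open>a - b\<close> enters.\<close>

lemma BL_dist_average_coupling_le:
  fixes a b :: "'a \<Rightarrow> 'b::euclidean_space" and \<phi> :: "'b \<Rightarrow> real ^ 'k::finite"
    and n :: nat and C \<delta> e \<eta> \<Lambda> :: real
  assumes K: "prob_space K" and n: "0 < n"
    and [measurable]: "a \<in> borel_measurable K" "b \<in> borel_measurable K" "\<phi> \<in> borel_measurable borel"
    and bounded: "\<And>\<omega>. \<omega> \<in> space K \<Longrightarrow> norm (a \<omega>) \<le> C" "\<And>\<omega>. \<omega> \<in> space K \<Longrightarrow> norm (b \<omega>) \<le> C"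
    and L: "bounded_linear L" "\<And>x. norm (L x) \<le> \<Lambda> * norm x" and \<Lambda>: "0 \<le> \<Lambda>"
    and strict: "\<And>x y. x \<in> ball (\<integral>\<omega>. b \<omega> \<partial>K) \<delta> \<Longrightarrow> y \<in> ball (\<integral>\<omega>. b \<omega> \<partial>K) \<delta> \<Longrightarrow>
        norm (\<phi> x - \<phi> y - L (x - y)) \<le> e * norm (x - y)"
    and \<delta>: "0 < \<delta>" and e: "0 \<le> e" and \<eta>: "0 < \<eta>"
    and close: "norm ((\<integral>\<omega>. a \<omega> \<partial>K) - (\<integral>\<omega>. b \<omega> \<partial>K)) < \<delta> / 2"
  defines "law \<equiv> \<lambda>v. distr (\<Pi>\<^sub>M i\<in>{..<n}. K) borel
      (\<lambda>\<omega>. sqrt n *\<^sub>R (\<phi> ((\<Sum>i<n. v (\<omega> i)) /\<^sub>R n) - \<phi> (\<integral>\<omega>. v \<omega> \<partial>K)))"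
  shows "BL_dist (law a) (law b) \<le> 16 * C\<^sup>2 / (n * \<delta>\<^sup>2) + 2 * e * (1 + C\<^sup>2)
      + \<Lambda> * (\<eta> + (\<integral>\<omega>. (norm (a \<omega> - b \<omega>))\<^sup>2 \<partial>K) / \<eta>)"
proof -
  interpret K: prob_space K by fact
  let ?R = "\<Pi>\<^sub>M i\<in>{..<n}. K"
  interpret P: prob_space ?R using K.prob_space_axioms by (rule prob_space_PiM)
  define avg where "avg v \<omega> = (\<Sum>i<n. v (\<omega> i)) /\<^sub>R n" for v :: "'a \<Rightarrow> 'b" and \<omega> :: "nat \<Rightarrow> 'a"
  define m where "m v = (\<integral>\<omega>. v \<omega> \<partial>K)" for v :: "'a \<Rightarrow> 'b"
  define Z where "Z v \<omega> = sqrt n *\<^sub>R (avg v \<omega> - m v)" for v \<omega>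
  define f where "f v \<omega> = sqrt n *\<^sub>R (\<phi> (avg v \<omega>) - \<phi> (m v))" for v \<omega>
  define c where "c \<omega> = a \<omega> - b \<omega>" for \<omega>
  have [measurable]: "c \<in> borel_measurable K" by (simp add: c_def[abs_def])
  have bounded_c: "norm (c \<omega>) \<le> 2 * C" if "\<omega> \<in> space K" for \<omega>
    unfolding c_def using norm_triangle_ineq4[of "a \<omega>" "b \<omega>"] bounded[OF that] by linarith
  have Z_c: "Z c \<omega> = Z a \<omega> - Z b \<omega>" for \<omega>
  proof -
    have "m c = m a - m b"
      unfolding m_def c_def
      by (intro Bochner_Integration.integral_diff K.integrable_bounded[where C = C] bounded) auto
    moreover have "avg c \<omega> = avg a \<omega> - avg b \<omega>"
      by (simp add: avg_def c_def sum_subtractf scaleR_diff_right)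
    ultimately have "avg c \<omega> - m c = (avg a \<omega> - m a) - (avg b \<omega> - m b)" by simp
    then show ?thesis by (simp only: Z_def scaleR_diff_right)
  qed
  have sq: "integrable ?R (\<lambda>\<omega>. (norm (Z v \<omega>))\<^sup>2)" "(\<integral>\<omega>. (norm (Z v \<omega>))\<^sup>2 \<partial>?R) \<le> (\<integral>\<omega>. (norm (v \<omega>))\<^sup>2 \<partial>K)"
    if "v \<in> borel_measurable K" "\<And>\<omega>. \<omega> \<in> space K \<Longrightarrow> norm (v \<omega>) \<le> c" for v c
    using expectation_sq_norm_average_PiM_le[OF K n that] unfolding Z_def avg_def m_def by auto
  have int: "integrable ?R (\<lambda>\<omega>. (norm (Z a \<omega>))\<^sup>2)" "integrable ?R (\<lambda>\<omega>. (norm (Z b \<omega>))\<^sup>2)"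
      "integrable ?R (\<lambda>\<omega>. (norm (Z c \<omega>))\<^sup>2)"
    using sq(1)[of a C] sq(1)[of b C] sq(1)[of c "2 * C"] bounded bounded_c by simp_all
  have C2: "(\<integral>\<omega>. (norm (v \<omega>))\<^sup>2 \<partial>K) \<le> C\<^sup>2"
    if "v \<in> borel_measurable K" "\<And>\<omega>. \<omega> \<in> space K \<Longrightarrow> norm (v \<omega>) \<le> C" for v :: "'a \<Rightarrow> 'b"
  proof -
    have "(\<integral>\<omega>. (norm (v \<omega>))\<^sup>2 \<partial>K) \<le> (\<integral>\<omega>. C\<^sup>2 \<partial>K)"
      using that by (intro integral_mono K.integrable_bounded[where C = "C\<^sup>2"]) (auto intro!: power_mono)
    then show ?thesis by (simp add: K.prob_space)
  qed
  have Za: "(\<integral>\<omega>. (norm (Z a \<omega>))\<^sup>2 \<partial>?R) \<le> C\<^sup>2" and Zb: "(\<integral>\<omega>. (norm (Z b \<omega>))\<^sup>2 \<partial>?R) \<le> C\<^sup>2"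
    using sq(2)[of a C] sq(2)[of b C] C2[of a] C2[of b] bounded by force+
  have Zc: "(\<integral>\<omega>. (norm (Z c \<omega>))\<^sup>2 \<partial>?R) \<le> (\<integral>\<omega>. (norm (a \<omega> - b \<omega>))\<^sup>2 \<partial>K)"
    using sq(2)[of c "2 * C"] bounded_c by (simp add: c_def)
  \<comment> \<open>The squared norm of \<open>Z\<close> is n times the squared deviation, hence at
    least \<open>n * \<delta>\<^sup>2 / 4\<close> once the deviation reaches
    \<open>\<delta> / 2\<close>; the factor \<open>8 / (n * \<delta>\<^sup>2)\<close> lifts this to
    the cap 2. The other two terms come from \<open>le_add_sq_divide\<close> with parameters 1
    (twice) and \<eta>.\<close>
  define B where "B \<omega> = 8 / (n * \<delta>\<^sup>2) * ((norm (Z a \<omega>))\<^sup>2 + (norm (Z b \<omega>))\<^sup>2)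
      + e * (2 + (norm (Z a \<omega>))\<^sup>2 + (norm (Z b \<omega>))\<^sup>2) + \<Lambda> * (\<eta> + (norm (Z c \<omega>))\<^sup>2 / \<eta>)" for \<omega>
  have far: "2 \<le> 8 / (n * \<delta>\<^sup>2) * (norm (Z v \<omega>))\<^sup>2" if "\<delta> / 2 \<le> norm (avg v \<omega> - m v)" for v \<omega>
  proof -
    have "(\<delta> / 2)\<^sup>2 \<le> (norm (avg v \<omega> - m v))\<^sup>2"
      using that \<delta> by (intro power_mono) auto
    then show ?thesis
      unfolding Z_def norm_scaleR power_mult_distrib using n \<delta> by (simp add: field_simps)
  qed
  \<comment> \<open>For \<open>v = a\<close> neither point is the centre of the ball: the base point
    \<open>m a\<close> is only close to \<open>m b\<close>. This is where strictness of the
    derivative is used.\<close>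
  have near: "norm (f v \<omega> - L (Z v \<omega>)) \<le> e * norm (Z v \<omega>)"
    if "avg v \<omega> \<in> ball (m b) \<delta>" "m v \<in> ball (m b) \<delta>" for v \<omega>
  proof -
    have "L (Z v \<omega>) = sqrt n *\<^sub>R L (avg v \<omega> - m v)"
      unfolding Z_def by (rule linear_scale[OF bounded_linear.linear[OF L(1)]])
    then have "f v \<omega> - L (Z v \<omega>) = sqrt n *\<^sub>R (\<phi> (avg v \<omega>) - \<phi> (m v) - L (avg v \<omega> - m v))"
      by (simp only: f_def scaleR_diff_right)
    moreover have "norm (\<phi> (avg v \<omega>) - \<phi> (m v) - L (avg v \<omega> - m v)) \<le> e * norm (avg v \<omega> - m v)"
      using strict that by (simp add: m_def)
    ultimately have "norm (f v \<omega> - L (Z v \<omega>)) \<le> sqrt n * (e * norm (avg v \<omega> - m v))"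
      by (simp add: mult_left_mono)
    also have "\<dots> = e * norm (Z v \<omega>)"
      unfolding Z_def norm_scaleR by simp
    finally show ?thesis .
  qed
  have pointwise: "min 2 (norm (f a \<omega> - f b \<omega>)) \<le> B \<omega>" for \<omega>
  \<comment> \<open>Half the radius is reserved for the distance from \<open>m a\<close> to
    \<open>m b\<close>, so that the average of \<open>a\<close> still lies in the ball around
    \<open>m b\<close>. In the far case the cap 2 alone is used.\<close>
  proof (cases "\<delta> / 2 \<le> norm (avg a \<omega> - m a) \<or> \<delta> / 2 \<le> norm (avg b \<omega> - m b)")
    case True
    then have "2 \<le> 8 / (n * \<delta>\<^sup>2) * ((norm (Z a \<omega>))\<^sup>2 + (norm (Z b \<omega>))\<^sup>2)"
    proof
      assume "\<delta> / 2 \<le> norm (avg a \<omega> - m a)"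
      from far[OF this] show ?thesis
        by (rule order_trans) (intro mult_left_mono, auto)
    next
      assume "\<delta> / 2 \<le> norm (avg b \<omega> - m b)"
      from far[OF this] show ?thesis
        by (rule order_trans) (intro mult_left_mono, auto)
    qed
    moreover have "0 \<le> e * (2 + (norm (Z a \<omega>))\<^sup>2 + (norm (Z b \<omega>))\<^sup>2)" "0 \<le> \<Lambda> * (\<eta> + (norm (Z c \<omega>))\<^sup>2 / \<eta>)"
      using e \<Lambda> \<eta> by auto
    ultimately show ?thesis by (simp add: B_def)
  next
    case False
    have "norm (avg a \<omega> - m b) < \<delta>"
      using norm_triangle_ineq[of "avg a \<omega> - m a" "m a - m b"] False close by (simp add: m_def)
    then have a: "norm (f a \<omega> - L (Z a \<omega>)) \<le> e * norm (Z a \<omega>)"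
      using close \<delta> by (intro near) (auto simp: dist_norm m_def norm_minus_commute)
    have b: "norm (f b \<omega> - L (Z b \<omega>)) \<le> e * norm (Z b \<omega>)"
      using False \<delta> by (intro near) (auto simp: dist_norm norm_minus_commute)
    have "f a \<omega> - f b \<omega> = (f a \<omega> - L (Z a \<omega>)) - (f b \<omega> - L (Z b \<omega>)) + L (Z c \<omega>)"
      using L(1) by (simp add: Z_c bounded_linear.linear linear_diff)
    then have "norm (f a \<omega> - f b \<omega>) \<le> norm (f a \<omega> - L (Z a \<omega>)) + norm (f b \<omega> - L (Z b \<omega>)) + norm (L (Z c \<omega>))"
      by (metis norm_triangle_mono norm_triangle_ineq4 order_refl)
    also have "\<dots> \<le> e * norm (Z a \<omega>) + e * norm (Z b \<omega>) + \<Lambda> * norm (Z c \<omega>)"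
      by (intro add_mono a b L(2))
    also have "\<dots> \<le> e * (1 + (norm (Z a \<omega>))\<^sup>2) + e * (1 + (norm (Z b \<omega>))\<^sup>2) + \<Lambda> * (\<eta> + (norm (Z c \<omega>))\<^sup>2 / \<eta>)"
      using le_add_sq_divide[of 1] le_add_sq_divide[OF \<eta>] e \<Lambda>
      by (intro add_mono mult_left_mono) auto
    also have "\<dots> \<le> B \<omega>"
      by (simp add: B_def algebra_simps)
    finally show ?thesis by simp
  qed
  have "BL_dist (distr ?R borel (f a)) (distr ?R borel (f b)) \<le> (\<integral>\<omega>. B \<omega> \<partial>?R)"
  proof (rule BL_dist_coupling_le[OF P.prob_space_axioms])
    have "f v \<in> borel_measurable ?R" if "v \<in> borel_measurable K" for v
      using that unfolding f_def avg_def by measurable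
    then show "f a \<in> borel_measurable ?R" "f b \<in> borel_measurable ?R" by auto
    show "integrable ?R B"
      unfolding B_def[abs_def] using int by auto
  qed (rule pointwise)
  also have "(\<integral>\<omega>. B \<omega> \<partial>?R) = 8 / (n * \<delta>\<^sup>2) * ((\<integral>\<omega>. (norm (Z a \<omega>))\<^sup>2 \<partial>?R) + (\<integral>\<omega>. (norm (Z b \<omega>))\<^sup>2 \<partial>?R))
      + e * (2 + (\<integral>\<omega>. (norm (Z a \<omega>))\<^sup>2 \<partial>?R) + (\<integral>\<omega>. (norm (Z b \<omega>))\<^sup>2 \<partial>?R))
      + \<Lambda> * (\<eta> + (\<integral>\<omega>. (norm (Z c \<omega>))\<^sup>2 \<partial>?R) / \<eta>)"
    unfolding B_def using int by (simp add: P.prob_space)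
  also have "\<dots> \<le> 8 / (n * \<delta>\<^sup>2) * (C\<^sup>2 + C\<^sup>2) + e * (2 + C\<^sup>2 + C\<^sup>2)
      + \<Lambda> * (\<eta> + (\<integral>\<omega>. (norm (a \<omega> - b \<omega>))\<^sup>2 \<partial>K) / \<eta>)"
    using Za Zb Zc e \<Lambda> \<eta>
    by (intro add_mono mult_left_mono divide_right_mono) auto
  also have "\<dots> = 16 * C\<^sup>2 / (n * \<delta>\<^sup>2) + 2 * e * (1 + C\<^sup>2) + \<Lambda> * (\<eta> + (\<integral>\<omega>. (norm (a \<omega> - b \<omega>))\<^sup>2 \<partial>K) / \<eta>)"
    by (simp add: algebra_simps)
  finally show ?thesis
    by (simp add: law_def f_def[abs_def] avg_def m_def)
qed

subsection \<open>Quantile coupling\<close>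

text \<open>The interval is open because a quantile at level 0 or 1 need not exist as a real
  number.\<close>

abbreviation uniform01 :: "real measure" where
  "uniform01 \<equiv> restrict_space lborel {0<..<1}"

lemma prob_space_uniform01: "prob_space uniform01"
  by (auto simp: emeasure_restrict_space space_restrict_space intro!: prob_spaceI)

text \<open>The indicators differ exactly on the half-open interval between the two points, whose
  length is the distance. This expresses a distance of quantiles as an integral over
  thresholds.\<close>

lemma nn_integral_indicator_diff:
  fixes x y :: real
  assumes "x \<in> {0..1}" "y \<in> {0..1}"
  shows "(\<integral>\<^sup>+t\<in>{0..1}. ennreal \<bar>indicator {x..} t - indicator {y..} t\<bar> \<partial>lborel) = ennreal \<bar>x - y\<bar>"
proof -
  have "(\<integral>\<^sup>+t\<in>{0..1}. ennreal \<bar>indicator {x..} t - indicator {y..} t\<bar> \<partial>lborel)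
      = (\<integral>\<^sup>+t. indicator {min x y..<max x y} t \<partial>lborel)"
    using assms by (intro nn_integral_cong) (auto simp: indicator_def min_def max_def)
  also have "\<dots> = ennreal \<bar>x - y\<bar>"
    by (simp add: min_def max_def)
  finally show ?thesis .
qed

lemma nn_integral_uniform01_indicator_diff:
  fixes x y :: real
  assumes "x \<in> {0..1}" "y \<in> {0..1}"
  shows "(\<integral>\<^sup>+u. ennreal \<bar>indicator {..x} u - indicator {..y} u\<bar> \<partial>uniform01) = ennreal \<bar>x - y\<bar>"
proof -
  have "(\<integral>\<^sup>+u. ennreal \<bar>indicator {..x} u - indicator {..y} u\<bar> \<partial>uniform01)
      = (\<integral>\<^sup>+u. indicator {min x y<..min 1 (max x y)} u \<partial>lborel)"
  proof (subst nn_integral_restrict_space)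
    \<comment> \<open>If the larger point is 1, the half-open interval contains 1 while the open
      unit interval does not; the discrepancy is a null set.\<close>
    have "AE u in lborel. u \<noteq> (1 :: real)" by (rule AE_lborel_singleton)
    then have "AE u in lborel. ennreal \<bar>indicator {..x} u - indicator {..y} u\<bar> * indicator {0<..<1} u
        = indicator {min x y<..min 1 (max x y)} u"
      by eventually_elim (use assms in \<open>auto simp: indicator_def min_def max_def\<close>)
    then show "(\<integral>\<^sup>+u. ennreal \<bar>indicator {..x} u - indicator {..y} u\<bar> * indicator {0<..<1} u \<partial>lborel)
        = (\<integral>\<^sup>+u. indicator {min x y<..min 1 (max x y)} u \<partial>lborel)"
      by (rule nn_integral_cong_AE)
  qed simp
  also have "\<dots> = ennreal \<bar>x - y\<bar>"
    using assms by (auto simp add: min_def max_def)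
  finally show ?thesis .
qed

text \<open>The area formula for the first Wasserstein distance on the line. The equivalence of
  \<open>u \<le> cdf \<mu> x\<close> and \<open>A u \<le> x\<close> lets the same region of pairs
  (u, t) be sliced in two ways: at fixed u its length is the distance of the quantiles, at fixed t
  the difference of the distribution functions. Fubini equates the two.\<close>

lemma quantile_coupling:
  assumes "real_distribution \<mu>" "real_distribution \<nu>"
    and "measure \<mu> {0..1} = 1" "measure \<nu> {0..1} = 1"
  obtains A B where "A \<in> borel_measurable uniform01" "B \<in> borel_measurable uniform01"
    "distr uniform01 borel A = \<mu>" "distr uniform01 borel B = \<nu>"
    "\<And>u. u \<in> space uniform01 \<Longrightarrow> A u \<in> {0..1}" "\<And>u. u \<in> space uniform01 \<Longrightarrow> B u \<in> {0..1}"
    "(\<integral>\<^sup>+u. ennreal \<bar>A u - B u\<bar> \<partial>uniform01) = (\<integral>\<^sup>+t\<in>{0..1}. ennreal \<bar>cdf \<mu> t - cdf \<nu> t\<bar> \<partial>lborel)"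
proof -
  interpret \<mu>: cdf_distribution \<mu> unfolding cdf_distribution_def by fact
  interpret \<nu>: cdf_distribution \<nu> unfolding cdf_distribution_def by fact
  have cdf_supp: "cdf M 1 = 1" "x < 0 \<Longrightarrow> cdf M x = 0"
    if M: "real_distribution M" "measure M {0..1} = 1" for M x
  proof -
    interpret M: real_distribution M by fact
    have "measure M {0..1} \<le> measure M {..1}"
      by (rule M.finite_measure_mono) auto
    then show "cdf M 1 = 1"
      using M(2) M.prob_le_1[of "{..1}"] by (simp add: cdf_def)
    assume "x < 0"
    then have "measure M ({..x} \<union> {0..1}) = measure M {..x} + measure M {0..1}"
      by (intro M.finite_measure_Union) auto
    then show "cdf M x = 0"
      using M(2) M.prob_le_1[of "{..x} \<union> {0..1}"] measure_nonneg[of M "{..x}"] by (simp add: cdf_def)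
  qed
  \<comment> \<open>As \<open>u \<le> 1 = cdf M 1\<close>, the quantile is at most 1. A negative
    quantile \<open>I\<close> would satisfy \<open>u \<le> cdf M I = 0\<close>, against
    \<open>0 < u\<close>.\<close>
  have range: "I \<in> {0..1}"
    if "real_distribution M" "measure M {0..1} = 1" "u \<in> space uniform01"
      "\<And>x. u \<le> cdf M x \<longleftrightarrow> I \<le> x" for M u and I :: real
  proof -
    have "0 < u" "u < 1" using that(3) by (auto simp: space_restrict_space)
    then show ?thesis
      using cdf_supp[OF that(1,2)] that(4)[of 1] that(4)[of I] by (cases "I < 0") auto
  qed
  define A where "A u = \<mu>.I u" for u
  define B where "B u = \<nu>.I u" for u
  have \<mu>I: "u \<le> cdf \<mu> x \<longleftrightarrow> A u \<le> x" and \<nu>I: "u \<le> cdf \<nu> x \<longleftrightarrow> B u \<le> x"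
    if "u \<in> space uniform01" for u x
    unfolding A_def B_def
    by (rule \<mu>.pseudoinverse \<nu>.pseudoinverse; use that in \<open>simp add: space_restrict_space\<close>)+
  have meas: "A \<in> borel_measurable uniform01" "B \<in> borel_measurable uniform01"
    using \<mu>.measurable_CI \<nu>.measurable_CI by (auto cong: measurable_cong_sets simp: sets_restrict_space A_def[abs_def] B_def[abs_def])
  have ranges: "A u \<in> {0..1}" "B u \<in> {0..1}" if "u \<in> space uniform01" for u
    using range[OF assms(1,3) that \<mu>I[OF that]] range[OF assms(2,4) that \<nu>I[OF that]] by auto
  interpret U: prob_space uniform01 by (rule prob_space_uniform01)
  interpret pair_sigma_finite uniform01 lborel ..
  have [measurable]: "cdf \<mu> \<in> borel_measurable borel" "cdf \<nu> \<in> borel_measurable borel"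
    by (rule \<mu>.measurable_C \<nu>.measurable_C)+
  have [measurable]: "(\<lambda>u. u) \<in> borel_measurable uniform01"
    by (intro measurable_restrict_space1) simp
  let ?h = "\<lambda>u t. ennreal \<bar>indicator {..cdf \<mu> t} u - indicator {..cdf \<nu> t} u\<bar> * indicator {0..1} t"
  have "(\<integral>\<^sup>+u. ennreal \<bar>A u - B u\<bar> \<partial>uniform01) = (\<integral>\<^sup>+u. \<integral>\<^sup>+t. ?h u t \<partial>lborel \<partial>uniform01)"
  proof (intro nn_integral_cong)
    fix u assume u: "u \<in> space uniform01"
    have "?h u t = ennreal \<bar>indicator {A u..} t - indicator {B u..} t\<bar> * indicator {0..1} t" for t
      using \<mu>I[OF u] \<nu>I[OF u] by (simp add: indicator_def)
    then show "ennreal \<bar>A u - B u\<bar> = (\<integral>\<^sup>+t. ?h u t \<partial>lborel)"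
      using nn_integral_indicator_diff[OF ranges[OF u]] by simp
  qed
  also have "\<dots> = (\<integral>\<^sup>+t. \<integral>\<^sup>+u. ?h u t \<partial>uniform01 \<partial>lborel)"
  proof (rule Fubini'[symmetric])
    \<comment> \<open>Written as a condition on the pair, the indicator is visibly jointly
      measurable; as an indicator of a set that varies with \<open>t\<close> it is not.\<close>
    have "(\<lambda>(u, t). ennreal \<bar>(if u \<le> cdf \<mu> t then 1 else 0) - (if u \<le> cdf \<nu> t then 1 else 0)\<bar> * indicator {0..1} t)
        \<in> borel_measurable (uniform01 \<Otimes>\<^sub>M lborel)"
      by measurable
    then show "(\<lambda>(u, t). ?h u t) \<in> borel_measurable (uniform01 \<Otimes>\<^sub>M lborel)"
      by (simp add: indicator_def)
  qed
  also have "\<dots> = (\<integral>\<^sup>+t\<in>{0..1}. ennreal \<bar>cdf \<mu> t - cdf \<nu> t\<bar> \<partial>lborel)"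
  proof (intro nn_integral_cong)
    fix t
    have m: "(\<lambda>u. ennreal \<bar>indicator {..cdf \<mu> t} u - indicator {..cdf \<nu> t} u\<bar>) \<in> borel_measurable uniform01"
      by (intro measurable_restrict_space1) simp
    show "(\<integral>\<^sup>+u. ?h u t \<partial>uniform01) = ennreal \<bar>cdf \<mu> t - cdf \<nu> t\<bar> * indicator {0..1} t"
      by (subst nn_integral_multc[OF m], subst nn_integral_uniform01_indicator_diff)
        (auto simp: cdf_def)
  qed
  finally have dist: "(\<integral>\<^sup>+u. ennreal \<bar>A u - B u\<bar> \<partial>uniform01)
      = (\<integral>\<^sup>+t\<in>{0..1}. ennreal \<bar>cdf \<mu> t - cdf \<nu> t\<bar> \<partial>lborel)" .
  have "distr uniform01 borel A = \<mu>" "distr uniform01 borel B = \<nu>"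
    unfolding A_def[abs_def] B_def[abs_def] by (rule \<mu>.distr_I_eq_M \<nu>.distr_I_eq_M)+
  from that[OF meas this ranges dist] show thesis .
qed

subsection \<open>Empirical distributions\<close>

lemma empirical_props:
  assumes "0 < n"
  shows real_distribution_empirical: "real_distribution (empirical n x)"
    and integral_empirical: "\<And>f :: real \<Rightarrow> 'b::euclidean_space. f \<in> borel_measurable borel \<Longrightarrow>
      (\<integral>y. f y \<partial>empirical n x) = (\<Sum>i<n. f (x i)) /\<^sub>R n"
proof -
  show "real_distribution (empirical n x)"
    unfolding empirical_def by (intro prob_space.real_distribution_distr measure_pmf.prob_space_axioms) simp
  fix f :: "real \<Rightarrow> 'b" assume [measurable]: "f \<in> borel_measurable borel"
  have "(\<integral>y. f y \<partial>empirical n x) = (\<integral>i. f (x i) \<partial>measure_pmf (pmf_of_set {..<n}))"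
    unfolding empirical_def by (rule integral_distr) auto
  also have "\<dots> = (\<Sum>i<n. pmf (pmf_of_set {..<n}) i *\<^sub>R f (x i))"
  proof -
    have "{..<n} \<noteq> {}" using assms by auto
    then show ?thesis by (intro integral_measure_pmf) auto
  qed
  also have "\<dots> = (\<Sum>i<n. f (x i)) /\<^sub>R n"
  proof -
    have "{..<n} \<noteq> {}" using assms by auto
    then show ?thesis by (simp add: scaleR_right.sum divide_inverse)
  qed
  finally show "(\<integral>y. f y \<partial>empirical n x) = (\<Sum>i<n. f (x i)) /\<^sub>R n" .
qed

text \<open>Allows resampling from the raw data to be replaced by resampling from their transforms,
  which lie in [0, 1] as the quantile coupling requires.\<close>

lemma distr_empirical:
  assumes "U \<in> borel_measurable borel"
  shows "distr (empirical n x) borel U = empirical n (\<lambda>i. U (x i))"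
  unfolding empirical_def by (subst distr_distr) (use assms in \<open>auto simp: comp_def\<close>)

lemma cdf_empirical:
  assumes "0 < n"
  shows "cdf (empirical n x) t = (\<Sum>i<n. indicator {..t} (x i)) / n"
proof -
  interpret real_distribution "empirical n x" by (rule real_distribution_empirical[OF assms])
  have "cdf (empirical n x) t = (\<integral>y. indicator {..t} y \<partial>empirical n x)"
    by (simp add: cdf_def)
  also have "\<dots> = (\<Sum>i<n. indicator {..t} (x i)) / n"
    by (subst integral_empirical[OF assms]) (auto simp: divide_inverse)
  finally show ?thesis .
qed

text \<open>At a fixed threshold the empirical distribution function is an average of independent
  indicators, with second moments at most 1. The constant 2 is 1 + 1: a norm is at most 1 plus its
  square, and the expected square is at most 1.\<close>

lemma (in prob_space) expectation_cdf_empirical_diff_le: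
  assumes n: "0 < n" and indep: "indep_vars (\<lambda>_. borel) Y {..<n}"
    and dist: "\<And>i. i < n \<Longrightarrow> distr M borel (Y i) = \<nu>"
  shows "(\<integral>\<^sup>+\<omega>. ennreal \<bar>cdf (empirical n (\<lambda>i. Y i \<omega>)) t - cdf \<nu> t\<bar> \<partial>M) \<le> ennreal (2 / sqrt n)"
proof -
  have [measurable]: "Y i \<in> borel_measurable M" if "i < n" for i
    using indep that by (auto simp: indep_vars_def)
  define Z where "Z \<omega> = sqrt n *\<^sub>R ((\<Sum>i<n. indicator {..t} (Y i \<omega>)) /\<^sub>R n - cdf \<nu> t)" for \<omega>
  have mean: "expectation (\<lambda>\<omega>. indicator {..t} (Y i \<omega>)) = cdf \<nu> t" if "i < n" for i
  proof -
    have "expectation (\<lambda>\<omega>. indicator {..t} (Y i \<omega>)) = (\<integral>y. indicator {..t} y \<partial>\<nu> :: real)"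
      unfolding dist[OF that, symmetric] using that by (subst integral_distr) auto
    also have "\<dots> = cdf \<nu> t"
      using dist[OF that] by (auto simp: cdf_def)
    finally show ?thesis .
  qed
  have second: "expectation (\<lambda>\<omega>. (norm (indicator {..t} (Y i \<omega>) :: real))\<^sup>2) \<le> 1" if "i < n" for i
    using that by (intro integral_le_const integrable_bounded[where C = 1]) (auto simp: indicator_def)
  have indep': "indep_vars (\<lambda>_. borel) (\<lambda>i \<omega>. indicator {..t} (Y i \<omega>) :: real) {..<n}"
    by (rule indep_vars_compose2[OF indep]) auto
  have Z: "integrable M (\<lambda>\<omega>. (norm (Z \<omega>))\<^sup>2)" "expectation (\<lambda>\<omega>. (norm (Z \<omega>))\<^sup>2) \<le> 1"
    unfolding Z_def using expectation_sq_norm_average_le[OF n indep', where C = 1 and D = 1] mean second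
    by (auto simp: indicator_def)
  have le: "\<bar>cdf (empirical n (\<lambda>i. Y i \<omega>)) t - cdf \<nu> t\<bar> \<le> (1 + (norm (Z \<omega>))\<^sup>2) / sqrt n" for \<omega>
  proof -
    have "\<bar>cdf (empirical n (\<lambda>i. Y i \<omega>)) t - cdf \<nu> t\<bar> = norm (Z \<omega>) / sqrt n"
      unfolding Z_def norm_scaleR using n
      by (simp add: cdf_empirical) (simp add: divide_inverse mult.commute)
    also have "\<dots> \<le> (1 + (norm (Z \<omega>))\<^sup>2) / sqrt n"
      \<comment> \<open>Expanding this square bounds the norm by its square plus 1/4.\<close>
      using zero_le_power2[of "norm (Z \<omega>) - 1/2"]
      by (intro divide_right_mono) (auto simp: power2_eq_square algebra_simps)
    finally show ?thesis .
  qed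
  have "(\<integral>\<^sup>+\<omega>. ennreal \<bar>cdf (empirical n (\<lambda>i. Y i \<omega>)) t - cdf \<nu> t\<bar> \<partial>M)
      \<le> (\<integral>\<^sup>+\<omega>. ennreal ((1 + (norm (Z \<omega>))\<^sup>2) / sqrt n) \<partial>M)"
    by (intro nn_integral_mono ennreal_leI le)
  also have "\<dots> = ennreal (expectation (\<lambda>\<omega>. (1 + (norm (Z \<omega>))\<^sup>2) / sqrt n))"
    using Z(1) by (intro nn_integral_eq_integral) auto
  also have "\<dots> \<le> ennreal (2 / sqrt n)"
    using Z by (intro ennreal_leI) (simp add: prob_space divide_right_mono)
  finally show ?thesis .
qed

text \<open>Tonelli moves the expectation inside, where the bound holds at each threshold
  separately. It is unchanged by the integration because [0, 1] has length 1.\<close>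

lemma (in prob_space) nn_integral_cdf_empirical_diff_le:
  assumes n: "0 < n" and indep: "indep_vars (\<lambda>_. borel) Y {..<n}"
    and dist: "\<And>i. i < n \<Longrightarrow> distr M borel (Y i) = \<nu>"
  defines "W \<equiv> \<lambda>\<omega>. \<integral>\<^sup>+t\<in>{0..1::real}. ennreal \<bar>cdf (empirical n (\<lambda>i. Y i \<omega>)) t - cdf \<nu> t\<bar> \<partial>lborel"
  shows "W \<in> borel_measurable M" and "(\<integral>\<^sup>+\<omega>. W \<omega> \<partial>M) \<le> ennreal (2 / sqrt n)"
proof -
  have [measurable]: "Y i \<in> borel_measurable M" if "i < n" for i
    using indep that by (auto simp: indep_vars_def)
  interpret \<nu>: real_distribution \<nu>
    using dist[OF n] n real_distribution_distr[of "Y 0"] by auto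
  have [measurable]: "cdf \<nu> \<in> borel_measurable borel"
    by (intro borel_measurable_mono monoI \<nu>.cdf_nondecreasing)
  interpret pair_sigma_finite lborel M ..
  let ?h = "\<lambda>\<omega> t. ennreal \<bar>cdf (empirical n (\<lambda>i. Y i \<omega>)) t - cdf \<nu> t\<bar> * indicator {0..1::real} t"
  \<comment> \<open>A finite sum of conditions \<open>Y i \<omega> \<le> t\<close> exhibits joint
    measurability in (\<omega>, t), which Tonelli needs.\<close>
  have eq: "?h \<omega> t = ennreal \<bar>(\<Sum>i<n. if Y i \<omega> \<le> t then 1 else 0) / n - cdf \<nu> t\<bar> * indicator {0..1} t" for \<omega> t
    by (simp only: cdf_empirical[OF n] indicator_def atMost_iff of_bool_def)
  have h[measurable]: "(\<lambda>(\<omega>, t). ?h \<omega> t) \<in> borel_measurable (M \<Otimes>\<^sub>M lborel)"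
    unfolding eq by measurable
  show "W \<in> borel_measurable M"
    unfolding W_def using h by (intro lborel.borel_measurable_nn_integral)
  have "(\<integral>\<^sup>+\<omega>. W \<omega> \<partial>M) = (\<integral>\<^sup>+t. \<integral>\<^sup>+\<omega>. ?h \<omega> t \<partial>M \<partial>lborel)"
    unfolding W_def by (rule Fubini') (use h in \<open>measurable\<close>)
  also have "\<dots> \<le> (\<integral>\<^sup>+t. ennreal (2 / sqrt n) * indicator {0..1::real} t \<partial>lborel)"
  proof (intro nn_integral_mono)
    fix t :: real
    have m: "(\<lambda>\<omega>. ennreal \<bar>cdf (empirical n (\<lambda>i. Y i \<omega>)) t - cdf \<nu> t\<bar>) \<in> borel_measurable M"
      unfolding cdf_empirical[OF n] by measurable
    show "(\<integral>\<^sup>+\<omega>. ?h \<omega> t \<partial>M) \<le> ennreal (2 / sqrt n) * indicator {0..1} t"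
      by (subst nn_integral_multc[OF m]) (intro mult_right_mono expectation_cdf_empirical_diff_le n indep dist, auto)
  qed
  also have "\<dots> = ennreal (2 / sqrt n)"
    by (simp add: nn_integral_cmult_indicator)
  finally show "(\<integral>\<^sup>+\<omega>. W \<omega> \<partial>M) \<le> ennreal (2 / sqrt n)" .
qed

section \<open>Measurability of the bounded-Lipschitz distance in the data\<close>

text \<open>Taking suprema is a contraction in the uniform norm, so a Lipschitz bound common to all
  members of a family passes to their supremum.\<close>

lemma abs_SUP_diff_le:
  fixes f g :: "'a \<Rightarrow> real"
  assumes "A \<noteq> {}" "bdd_above (f ` A)" "bdd_above (g ` A)" "\<And>a. a \<in> A \<Longrightarrow> \<bar>f a - g a\<bar> \<le> B"
  shows "\<bar>(SUP a\<in>A. f a) - (SUP a\<in>A. g a)\<bar> \<le> B"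
proof -
  have "(SUP a\<in>A. f a) \<le> (SUP a\<in>A. g a) + B"
    using assms by (intro cSUP_least) (force intro: order_trans[OF _ add_right_mono[OF cSUP_upper]] dest: assms(4))+
  moreover have "(SUP a\<in>A. g a) \<le> (SUP a\<in>A. f a) + B"
    using assms by (intro cSUP_least) (force intro: order_trans[OF _ add_right_mono[OF cSUP_upper]] dest: assms(4))+
  ultimately show ?thesis by linarith
qed

text \<open>The supremum runs over an uncountable family, but it is Lipschitz in the finitely many points.\<close>

lemma borel_measurable_SUP_BL:
  fixes z :: "'c \<Rightarrow> 'a \<Rightarrow> real ^ 'k::finite" and c :: "(real ^ 'k \<Rightarrow> real) \<Rightarrow> real"
  defines "H \<equiv> {h :: real ^ 'k \<Rightarrow> real. (\<forall>x. \<bar>h x\<bar> \<le> 1) \<and> 1-lipschitz_on UNIV h}"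
  assumes F: "finite F" and w: "\<And>f. f \<in> F \<Longrightarrow> 0 \<le> w f"
    and z[measurable]: "\<And>f. f \<in> F \<Longrightarrow> z f \<in> borel_measurable M"
    and c: "\<And>h. h \<in> H \<Longrightarrow> \<bar>c h\<bar> \<le> 1"
  shows "(\<lambda>\<omega>. SUP h\<in>H. \<bar>(\<Sum>f\<in>F. w f * h (z f \<omega>)) - c h\<bar>) \<in> borel_measurable M"
proof -
  \<comment> \<open>Coding \<open>F\<close> into the naturals turns the finitely many points into a
    sequence. The space of sequences has a product topology in which \<open>\<Phi>\<close> is
    continuous, and measurability into it is checked coordinate by coordinate.\<close>
  define e where "e = to_nat_on F"
  have inj: "inj_on e F" unfolding e_def using F by (intro inj_on_to_nat_on countable_finite)
  define S where "S y h = (\<Sum>f\<in>F. w f * h (y (e f)))" for y :: "nat \<Rightarrow> real ^ 'k" and h :: "real ^ 'k \<Rightarrow> real"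
  define \<Phi> where "\<Phi> y = (SUP h\<in>H. \<bar>S y h - c h\<bar>)" for y
  have H: "H \<noteq> {}"
    by (auto simp: H_def lipschitz_on_def intro!: exI[of _ "\<lambda>_. 0"])
  have bdd: "bdd_above ((\<lambda>h. \<bar>S y h - c h\<bar>) ` H)" for y
  proof (rule bdd_aboveI2)
    fix h assume h: "h \<in> H"
    have "\<bar>S y h\<bar> \<le> (\<Sum>f\<in>F. \<bar>w f * h (y (e f))\<bar>)"
      unfolding S_def by (rule sum_abs)
    also have "\<dots> \<le> (\<Sum>f\<in>F. w f * 1)"
      unfolding abs_mult using h w by (intro sum_mono mult_mono) (auto simp: H_def)
    finally show "\<bar>S y h - c h\<bar> \<le> (\<Sum>f\<in>F. w f) + 1"
      using c[OF h] by simp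
  qed
  have lip: "\<bar>\<Phi> y - \<Phi> y'\<bar> \<le> (\<Sum>f\<in>F. w f * norm (y (e f) - y' (e f)))" for y y'
    unfolding \<Phi>_def
  proof (rule abs_SUP_diff_le[OF H bdd bdd])
    fix h assume h: "h \<in> H"
    have "\<bar>\<bar>S y h - c h\<bar> - \<bar>S y' h - c h\<bar>\<bar> \<le> \<bar>S y h - S y' h\<bar>"
      by linarith
    also have "\<dots> = \<bar>\<Sum>f\<in>F. w f * (h (y (e f)) - h (y' (e f)))\<bar>"
      by (simp add: S_def sum_subtractf right_diff_distrib)
    also have "\<dots> \<le> (\<Sum>f\<in>F. \<bar>w f * (h (y (e f)) - h (y' (e f)))\<bar>)"
      by (rule sum_abs)
    also have "\<dots> \<le> (\<Sum>f\<in>F. w f * norm (y (e f) - y' (e f)))"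
    proof (intro sum_mono)
      fix f assume "f \<in> F"
      have "\<bar>h (y (e f)) - h (y' (e f))\<bar> \<le> norm (y (e f) - y' (e f))"
        using h lipschitz_onD[of 1 UNIV h "y (e f)" "y' (e f)"] by (auto simp: H_def dist_norm)
      then show "\<bar>w f * (h (y (e f)) - h (y' (e f)))\<bar> \<le> w f * norm (y (e f) - y' (e f))"
        using w[OF \<open>f \<in> F\<close>] by (simp add: abs_mult mult_left_mono)
    qed
    finally show "\<bar>\<bar>S y h - c h\<bar> - \<bar>S y' h - c h\<bar>\<bar> \<le> (\<Sum>f\<in>F. w f * norm (y (e f) - y' (e f)))" .
  qed
  have "isCont \<Phi> y" for y
  proof -
    have "continuous_on UNIV (\<lambda>y'. \<Sum>f\<in>F. w f * norm (y' (e f) - y (e f)))"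
      by (intro continuous_intros continuous_on_product_coordinates)
    then have "((\<lambda>y'. \<Sum>f\<in>F. w f * norm (y' (e f) - y (e f))) \<longlongrightarrow> 0) (at y)"
      unfolding continuous_on_eq_continuous_at[OF open_UNIV] isCont_def by (auto dest!: spec[of _ y])
    then have "((\<lambda>y'. \<Phi> y' - \<Phi> y) \<longlongrightarrow> 0) (at y)"
      by (rule Lim_null_comparison[rotated]) (simp add: lip)
    then show ?thesis unfolding isCont_def by (simp add: LIM_zero_iff)
  qed
  then have [measurable]: "\<Phi> \<in> borel_measurable borel"
    by (intro borel_measurable_continuous_onI continuous_at_imp_continuous_on) auto
  \<comment> \<open>Coordinates outside the code of \<open>F\<close> get the default 0; the sum
    \<open>S\<close> never reads them.\<close>
  have "(\<lambda>\<omega> j. if j \<in> e ` F then z (inv_into F e j) \<omega> else 0) \<in> borel_measurable M"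
  proof (rule measurable_coordinatewise_then_product)
    fix j
    show "(\<lambda>\<omega>. if j \<in> e ` F then z (inv_into F e j) \<omega> else 0) \<in> borel_measurable M"
      by (cases "j \<in> e ` F") (auto intro!: z inv_into_into)
  qed
  then have "(\<lambda>\<omega>. \<Phi> (\<lambda>j. if j \<in> e ` F then z (inv_into F e j) \<omega> else 0)) \<in> borel_measurable M"
    by measurable
  moreover have "S (\<lambda>j. if j \<in> e ` F then z (inv_into F e j) \<omega> else 0) h = (\<Sum>f\<in>F. w f * h (z f \<omega>))" for \<omega> h
    unfolding S_def using inj by (intro sum.cong refl) simp
  ultimately show ?thesis
    by (simp add: \<Phi>_def)
qed

text \<open>The product measure is concentrated on the finitely many functions into the support, and
  each of these is a measurable point, being a box of singletons. The weights depend on the measure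
  alone; in the bootstrap they are the same for all data.\<close>

lemma integral_PiM_pmf_eq_sum:
  fixes p :: "nat pmf" and \<phi> :: "(nat \<Rightarrow> nat) \<Rightarrow> real"
  assumes "finite J" "finite (set_pmf p)"
    and [measurable]: "\<phi> \<in> borel_measurable (\<Pi>\<^sub>M i\<in>J. measure_pmf p)"
  shows "(\<integral>f. \<phi> f \<partial>(\<Pi>\<^sub>M i\<in>J. measure_pmf p))
    = (\<Sum>f\<in>J \<rightarrow>\<^sub>E set_pmf p. measure (\<Pi>\<^sub>M i\<in>J. measure_pmf p) {f} * \<phi> f)"
proof -
  let ?R = "\<Pi>\<^sub>M i\<in>J. measure_pmf p" and ?F = "J \<rightarrow>\<^sub>E set_pmf p"
  interpret R: prob_space ?R by (intro prob_space_PiM measure_pmf.prob_space_axioms)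
  have F: "finite ?F" using assms by (intro finite_PiE)
  have [measurable]: "{f} \<in> sets ?R" if "f \<in> ?F" for f
  proof -
    have "{f} = (\<Pi>\<^sub>E i\<in>J. {f i})"
      by (rule PiE_singleton[symmetric]) (use that in \<open>auto simp: PiE_iff\<close>)
    also have "\<dots> \<in> sets ?R" using \<open>finite J\<close> by (intro sets_PiM_I_finite) auto
    finally show ?thesis .
  qed
  have "AE f in ?R. \<forall>i\<in>J. f i \<in> set_pmf p"
    using \<open>finite J\<close>
    by (subst AE_finite_all)
      (auto intro!: AE_PiM_component[where M = "\<lambda>_. measure_pmf p"] measure_pmf.prob_space_axioms AE_pmfI)
  \<comment> \<open>Membership in \<open>?F\<close> needs extensionality besides the values in the
    support; this is what \<open>AE_space\<close> contributes.\<close>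
  then have "AE f in ?R. \<phi> f = (\<Sum>f'\<in>?F. indicator {f'} f * \<phi> f')"
    using AE_space
  proof eventually_elim
    fix f assume "\<forall>i\<in>J. f i \<in> set_pmf p" "f \<in> space ?R"
    then have "f \<in> ?F" by (auto simp: space_PiM PiE_iff)
    with F show "\<phi> f = (\<Sum>f'\<in>?F. indicator {f'} f * \<phi> f')"
      by (simp add: indicator_def if_distrib cong: if_cong)
  qed
  then have "(\<integral>f. \<phi> f \<partial>?R) = (\<integral>f. (\<Sum>f'\<in>?F. indicator {f'} f * \<phi> f') \<partial>?R)"
    by (intro integral_cong_AE) measurable
  also have "\<dots> = (\<Sum>f\<in>?F. measure ?R {f} * \<phi> f)"
    by (subst Bochner_Integration.integral_sum) (auto intro!: integrable_real_mult_indicator sum.cong simp: R.emeasure_eq_measure)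
  finally show ?thesis .
qed

subsection \<open>Strict derivatives\<close>

text \<open>Differentiability in the strict (strong) sense: both points vary in the ball, and
  neither has to be \<open>p\<close>.\<close>

definition strict_derivative ::
  "('a::real_normed_vector \<Rightarrow> 'b::real_normed_vector) \<Rightarrow> ('a \<Rightarrow> 'b) \<Rightarrow> 'a \<Rightarrow> bool" where
  "strict_derivative f L p \<longleftrightarrow> bounded_linear L \<and>
     (\<forall>e>0. \<exists>\<delta>>0. \<forall>x\<in>ball p \<delta>. \<forall>y\<in>ball p \<delta>. norm (f x - f y - L (x - y)) \<le> e * norm (x - y))"

lemma strict_derivativeI:
  assumes "bounded_linear L"
    and "\<And>e. e > 0 \<Longrightarrow> \<exists>\<delta>>0. \<forall>x\<in>ball p \<delta>. \<forall>y\<in>ball p \<delta>. norm (f x - f y - L (x - y)) \<le> e * norm (x - y)"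
  shows "strict_derivative f L p"
  using assms by (auto simp: strict_derivative_def)

lemma strict_derivative_bounded_linear:
  assumes "bounded_linear L"
  shows "strict_derivative L L p"
  using assms by (intro strict_derivativeI)
    (auto simp: linear_diff bounded_linear.linear intro!: exI[of _ "1::real"])

lemma strict_derivative_const: "strict_derivative (\<lambda>_. c) (\<lambda>_. 0) p"
  by (intro strict_derivativeI) (auto intro!: exI[of _ "1::real"])

lemma strict_derivative_add:
  assumes "strict_derivative f L p" "strict_derivative g L' p"
  shows "strict_derivative (\<lambda>x. f x + g x) (\<lambda>x. L x + L' x) p"
proof (rule strict_derivativeI)
  show "bounded_linear (\<lambda>x. L x + L' x)"
    using assms by (auto simp: strict_derivative_def intro: bounded_linear_add)
  fix e :: real assume e: "e > 0"
  then have "e / 2 > 0" by simp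
  obtain d where d: "d > 0" "\<And>x y. x \<in> ball p d \<Longrightarrow> y \<in> ball p d \<Longrightarrow>
      norm (f x - f y - L (x - y)) \<le> e / 2 * norm (x - y)"
    using assms(1) \<open>e / 2 > 0\<close> unfolding strict_derivative_def by meson
  obtain d' where d': "d' > 0" "\<And>x y. x \<in> ball p d' \<Longrightarrow> y \<in> ball p d' \<Longrightarrow>
      norm (g x - g y - L' (x - y)) \<le> e / 2 * norm (x - y)"
    using assms(2) \<open>e / 2 > 0\<close> unfolding strict_derivative_def by meson
  have "norm (f x + g x - (f y + g y) - (L (x - y) + L' (x - y))) \<le> e * norm (x - y)"
    if "x \<in> ball p (min d d')" "y \<in> ball p (min d d')" for x y
  proof -
    have "f x + g x - (f y + g y) - (L (x - y) + L' (x - y))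
        = (f x - f y - L (x - y)) + (g x - g y - L' (x - y))" by simp
    also have "norm \<dots> \<le> e / 2 * norm (x - y) + e / 2 * norm (x - y)"
      using that by (intro norm_triangle_mono d(2) d'(2)) auto
    finally show ?thesis by simp
  qed
  then show "\<exists>\<delta>>0. \<forall>x\<in>ball p \<delta>. \<forall>y\<in>ball p \<delta>.
      norm (f x + g x - (f y + g y) - (L (x - y) + L' (x - y))) \<le> e * norm (x - y)"
    using d(1) d'(1) by (intro exI[of _ "min d d'"]) auto
qed

lemma strict_derivative_compose_bounded_linear:
  assumes "strict_derivative f L p" "bounded_linear T"
  shows "strict_derivative (\<lambda>x. T (f x)) (\<lambda>x. T (L x)) p"
proof (rule strict_derivativeI)
  interpret T: bounded_linear T by fact
  show "bounded_linear (\<lambda>x. T (L x))"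
    using assms by (auto simp: strict_derivative_def intro: bounded_linear_compose)
  fix e :: real assume e: "e > 0"
  obtain K where K: "K > 0" "\<And>x. norm (T x) \<le> norm x * K"
    using T.pos_bounded by auto
  have "e / K > 0" using e K(1) by simp
  with assms(1) obtain d where d: "d > 0" "\<And>x y. x \<in> ball p d \<Longrightarrow> y \<in> ball p d \<Longrightarrow>
      norm (f x - f y - L (x - y)) \<le> e / K * norm (x - y)"
    unfolding strict_derivative_def by meson
  have "norm (T (f x) - T (f y) - T (L (x - y))) \<le> e * norm (x - y)"
    if "x \<in> ball p d" "y \<in> ball p d" for x y
  proof -
    have "norm (T (f x) - T (f y) - T (L (x - y))) \<le> norm (f x - f y - L (x - y)) * K"
      using K(2)[of "f x - f y - L (x - y)"] by (simp add: T.diff)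
    also have "\<dots> \<le> (e / K * norm (x - y)) * K"
      using d(2)[OF that] K(1) by (intro mult_right_mono) auto
    finally show ?thesis using K(1) by simp
  qed
  then show "\<exists>\<delta>>0. \<forall>x\<in>ball p \<delta>. \<forall>y\<in>ball p \<delta>.
      norm (T (f x) - T (f y) - T (L (x - y))) \<le> e * norm (x - y)"
    using d(1) by blast
qed

lemma strict_derivative_imp_lipschitz_near:
  assumes "strict_derivative f L p"
  obtains d K where "d > 0" "K \<ge> 0"
    "\<And>x y. x \<in> ball p d \<Longrightarrow> y \<in> ball p d \<Longrightarrow> norm (f x - f y) \<le> K * norm (x - y)"
proof -
  obtain d where d: "d > 0" "\<And>x y. x \<in> ball p d \<Longrightarrow> y \<in> ball p d \<Longrightarrow>
      norm (f x - f y - L (x - y)) \<le> 1 * norm (x - y)"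
    using assms zero_less_one unfolding strict_derivative_def by meson
  obtain B where B: "B > 0" "\<And>x. norm (L x) \<le> norm x * B"
    using assms bounded_linear.pos_bounded[of L] by (auto simp: strict_derivative_def)
  have "norm (f x - f y) \<le> (1 + B) * norm (x - y)" if "x \<in> ball p d" "y \<in> ball p d" for x y
    using d(2)[OF that] B(2)[of "x - y"] norm_triangle_ineq2[of "f x - f y" "L (x - y)"]
    by (simp add: algebra_simps)
  with d(1) B(1) show thesis by (intro that[of d "1 + B"]) auto
qed

text \<open>Besides the two linearisation errors, each multiplied by a factor frozen at
  \<open>p\<close>, products of increments remain. One factor of each such product is an increment
  from \<open>p\<close>, hence small with the radius; the other is of the order of the distance of
  \<open>x\<close> and \<open>y\<close>.\<close>

lemma strict_derivative_mult:
  fixes f g :: "'a::real_normed_vector \<Rightarrow> real"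
  assumes f: "strict_derivative f L p" and g: "strict_derivative g L' p"
  shows "strict_derivative (\<lambda>x. f x * g x) (\<lambda>x. L x * g p + f p * L' x) p"
proof (rule strict_derivativeI)
  have lin: "bounded_linear L" "bounded_linear L'"
    using assms by (auto simp: strict_derivative_def)
  then show "bounded_linear (\<lambda>x. L x * g p + f p * L' x)"
    by (intro bounded_linear_add bounded_linear_mult_const bounded_linear_const_mult)
  fix e :: real assume e: "e > 0"
  obtain df Kf where df: "df > 0" "Kf \<ge> 0"
    "\<And>x y. x \<in> ball p df \<Longrightarrow> y \<in> ball p df \<Longrightarrow> norm (f x - f y) \<le> Kf * norm (x - y)"
    using strict_derivative_imp_lipschitz_near[OF f] by blast
  obtain dg Kg where dg: "dg > 0" "Kg \<ge> 0"
    "\<And>x y. x \<in> ball p dg \<Longrightarrow> y \<in> ball p dg \<Longrightarrow> norm (g x - g y) \<le> Kg * norm (x - y)"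
    using strict_derivative_imp_lipschitz_near[OF g] by blast
  \<comment> \<open>Each of the four error terms is allotted a quarter of \<open>e\<close>:
    \<open>c\<close> handles the linearisation errors, and \<open>k\<close> below, as a bound on the
    radius, the products of increments. The summand 1 keeps both denominators positive.\<close>
  define c where "c = e / (4 * (1 + \<bar>f p\<bar> + \<bar>g p\<bar>))"
  have c: "c > 0" using e by (simp add: c_def add_pos_nonneg)
  have c_le: "\<bar>f p\<bar> * c \<le> e / 4" "\<bar>g p\<bar> * c \<le> e / 4"
    using e by (auto simp: c_def field_simps)
  obtain d where d: "d > 0" "\<And>x y. x \<in> ball p d \<Longrightarrow> y \<in> ball p d \<Longrightarrow>
      norm (f x - f y - L (x - y)) \<le> c * norm (x - y)"
    using f c unfolding strict_derivative_def by meson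
  obtain d' where d': "d' > 0" "\<And>x y. x \<in> ball p d' \<Longrightarrow> y \<in> ball p d' \<Longrightarrow>
      norm (g x - g y - L' (x - y)) \<le> c * norm (x - y)"
    using g c unfolding strict_derivative_def by meson
  define k where "k = e / (4 * (1 + Kf * Kg))"
  have k: "k > 0" using e df(2) dg(2) by (simp add: k_def add_pos_nonneg)
  have k_le: "Kf * Kg * k \<le> e / 4"
  proof -
    define q where "q = Kf * Kg"
    have "q \<ge> 0" using df(2) dg(2) by (simp add: q_def)
    then show ?thesis
      using e unfolding k_def q_def[symmetric] by (simp add: field_simps)
  qed
  define r where "r = Min {df, dg, d, d', k}"
  have r: "r > 0" "r \<le> df" "r \<le> dg" "r \<le> d" "r \<le> d'" "r \<le> k"
    using df(1) dg(1) d(1) d'(1) k by (auto simp: r_def)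
  have "norm (f x * g x - f y * g y - (L (x - y) * g p + f p * L' (x - y))) \<le> e * norm (x - y)"
    if x: "x \<in> ball p r" and y: "y \<in> ball p r" for x y
  proof -
    let ?t = "norm (x - y)"
    have in_ball: "x \<in> ball p s" "y \<in> ball p s" if "r \<le> s" for s
      using x y that by auto
    have p: "p \<in> ball p s" if "r \<le> s" for s using r(1) that by simp
    have split: "f x * g x - f y * g y - (L (x - y) * g p + f p * L' (x - y))
      = (f x - f y - L (x - y)) * g p + f p * (g x - g y - L' (x - y))
        + (f x - f y) * (g x - g p) + (f y - f p) * (g x - g y)"
      by (simp add: algebra_simps)
    have small: "norm (x - p) \<le> k" "norm (y - p) \<le> k"
      using x y r(6) by (auto simp: dist_norm norm_minus_commute)
    have 1: "\<bar>(f x - f y - L (x - y)) * g p\<bar> \<le> e / 4 * ?t"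
    proof -
      have "\<bar>(f x - f y - L (x - y)) * g p\<bar> \<le> (c * ?t) * \<bar>g p\<bar>"
        unfolding abs_mult using d(2)[OF in_ball[OF r(4)]] by (intro mult_right_mono) auto
      also have "\<dots> = (\<bar>g p\<bar> * c) * ?t" by simp
      also have "\<dots> \<le> e / 4 * ?t" by (intro mult_right_mono c_le) auto
      finally show ?thesis .
    qed
    have 2: "\<bar>f p * (g x - g y - L' (x - y))\<bar> \<le> e / 4 * ?t"
    proof -
      have "\<bar>f p * (g x - g y - L' (x - y))\<bar> \<le> \<bar>f p\<bar> * (c * ?t)"
        unfolding abs_mult using d'(2)[OF in_ball[OF r(5)]] by (intro mult_left_mono) auto
      also have "\<dots> = (\<bar>f p\<bar> * c) * ?t" by simp
      also have "\<dots> \<le> e / 4 * ?t" by (intro mult_right_mono c_le) auto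
      finally show ?thesis .
    qed
    have 3: "\<bar>(f x - f y) * (g x - g p)\<bar> \<le> e / 4 * ?t"
    proof -
      have "\<bar>(f x - f y) * (g x - g p)\<bar> \<le> (Kf * ?t) * (Kg * k)"
        unfolding abs_mult
        using df(3)[OF in_ball[OF r(2)]] order_trans[OF dg(3)[OF in_ball(1)[OF r(3)] p[OF r(3)]] mult_left_mono[OF small(1) dg(2)]] df(2)
        by (intro mult_mono) auto
      also have "\<dots> = (Kf * Kg * k) * ?t" by simp
      also have "\<dots> \<le> e / 4 * ?t" by (intro mult_right_mono k_le) auto
      finally show ?thesis .
    qed
    have 4: "\<bar>(f y - f p) * (g x - g y)\<bar> \<le> e / 4 * ?t"
    proof -
      have "\<bar>(f y - f p) * (g x - g y)\<bar> \<le> (Kf * k) * (Kg * ?t)"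
        unfolding abs_mult
        using dg(3)[OF in_ball[OF r(3)]] order_trans[OF df(3)[OF in_ball(2)[OF r(2)] p[OF r(2)]] mult_left_mono[OF small(2) df(2)]] df(2) k
        by (intro mult_mono) auto
      also have "\<dots> = (Kf * Kg * k) * ?t" by simp
      also have "\<dots> \<le> e / 4 * ?t" by (intro mult_right_mono k_le) auto
      finally show ?thesis .
    qed
    show ?thesis
      unfolding split real_norm_def using 1 2 3 4 by linarith
  qed
  then show "\<exists>\<delta>>0. \<forall>x\<in>ball p \<delta>. \<forall>y\<in>ball p \<delta>.
      norm (f x * g x - f y * g y - (L (x - y) * g p + f p * L' (x - y))) \<le> e * norm (x - y)"
    using r(1) by blast
qed

text \<open>From here on derivatives are left existential: consistency asks only that one exists,
  not for its formula.\<close>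

lemma strict_derivative_power:
  fixes f :: "'a::real_normed_vector \<Rightarrow> real"
  assumes "strict_derivative f L p"
  shows "\<exists>L'. strict_derivative (\<lambda>x. f x ^ n) L' p"
proof (induction n)
  case 0
  show ?case by (simp, rule exI, rule strict_derivative_const)
next
  case (Suc n)
  then obtain L' where "strict_derivative (\<lambda>x. f x ^ n) L' p" by blast
  from strict_derivative_mult[OF assms this] show ?case
    unfolding power_Suc by (intro exI)
qed

lemma strict_derivative_sum:
  assumes "finite A" "\<And>i. i \<in> A \<Longrightarrow> \<exists>L. strict_derivative (f i) L p"
  shows "\<exists>L. strict_derivative (\<lambda>x. \<Sum>i\<in>A. f i x) L p"
  using assms
proof (induction A rule: finite_induct)
  case empty
  show ?case by (simp, rule exI, rule strict_derivative_const)
next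
  case (insert i A)
  then obtain L L' where "strict_derivative (f i) L p" "strict_derivative (\<lambda>x. \<Sum>i\<in>A. f i x) L' p"
    by (meson insertCI)
  from strict_derivative_add[OF this] show ?case
    unfolding sum.insert[OF insert.hyps(1,2)] by (intro exI)
qed

lemma strict_derivative_vec_lambda:
  fixes f :: "'i::finite \<Rightarrow> 'a::real_normed_vector \<Rightarrow> real"
  assumes "\<And>i. \<exists>L. strict_derivative (f i) L p"
  shows "\<exists>L. strict_derivative (\<lambda>x. \<chi> i. f i x) L p"
proof -
  have "\<exists>L. strict_derivative (\<lambda>x. f i x *\<^sub>R axis i (1::real)) L p" for i
  proof -
    from assms[of i] obtain L where "strict_derivative (f i) L p" by blast
    from strict_derivative_compose_bounded_linear[OF this bounded_linear_scaleR_left] show ?thesis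
      by (intro exI)
  qed
  then have "\<exists>L. strict_derivative (\<lambda>x. \<Sum>i\<in>UNIV. f i x *\<^sub>R axis i (1::real)) L p"
    by (intro strict_derivative_sum) auto
  moreover have "(\<Sum>i\<in>UNIV. f i x *\<^sub>R axis i (1::real)) = (\<chi> i. f i x)" for x
    by (simp add: vec_eq_iff axis_def if_distrib cong: if_cong)
  ultimately show ?thesis by simp
qed

lemma strict_derivative_compose_right:
  fixes f :: "'b::real_normed_vector \<Rightarrow> 'c::real_normed_vector"
  assumes f: "strict_derivative f L (T p)" and T: "bounded_linear T"
  shows "strict_derivative (\<lambda>x. f (T x)) (\<lambda>x. L (T x)) p"
proof (rule strict_derivativeI)
  interpret T: bounded_linear T by fact
  show "bounded_linear (\<lambda>x. L (T x))"
    using f T by (auto simp: strict_derivative_def intro: bounded_linear_compose)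
  obtain K where K: "K > 0" "\<And>x. norm (T x) \<le> norm x * K"
    using T.pos_bounded by auto
  fix e :: real assume "e > 0"
  then have "e / K > 0" using K by simp
  with f obtain d where d: "d > 0" "\<And>x y. x \<in> ball (T p) d \<Longrightarrow> y \<in> ball (T p) d \<Longrightarrow>
      norm (f x - f y - L (x - y)) \<le> e / K * norm (x - y)"
    unfolding strict_derivative_def by meson
  have in_ball: "T x \<in> ball (T p) d" if "x \<in> ball p (d / K)" for x
  proof -
    have "dist (T p) (T x) \<le> dist p x * K"
      using K(2)[of "p - x"] by (simp add: dist_norm T.diff)
    also have "\<dots> < d" using that K(1) by (simp add: pos_less_divide_eq)
    finally show ?thesis by simp
  qed
  have "norm (f (T x) - f (T y) - L (T (x - y))) \<le> e * norm (x - y)"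
    if "x \<in> ball p (d / K)" "y \<in> ball p (d / K)" for x y
  proof -
    have "norm (f (T x) - f (T y) - L (T (x - y))) \<le> e / K * norm (T (x - y))"
      using d(2)[OF in_ball[OF that(1)] in_ball[OF that(2)]] by (simp add: T.diff)
    also have "\<dots> \<le> e / K * (norm (x - y) * K)"
      using \<open>e / K > 0\<close> by (intro mult_left_mono K(2)) auto
    finally show ?thesis using K(1) by simp
  qed
  then show "\<exists>\<delta>>0. \<forall>x\<in>ball p \<delta>. \<forall>y\<in>ball p \<delta>.
      norm (f (T x) - f (T y) - L (T (x - y))) \<le> e * norm (x - y)"
    using d(1) K(1) by (intro exI[of _ "d / K"]) auto
qed

text \<open>The mean value inequality on the convex ball, applied to \<open>G\<close> minus its
  linear part at \<open>m\<close>. The derivative of this difference is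
  \<open>deriv G z - deriv G m\<close>, which continuity at \<open>m\<close> makes small.\<close>

lemma C1_near_imp_strict_derivative:
  assumes "C1_near G m"
  shows "strict_derivative G (\<lambda>x. deriv G m * x) m"
proof (rule strict_derivativeI)
  show "bounded_linear (\<lambda>x. deriv G m * x)" by (rule bounded_linear_mult_right)
  fix e :: real assume e: "e > 0"
  obtain d1 where d1: "d1 > 0" "\<And>x. x \<in> ball m d1 \<Longrightarrow> G differentiable (at x)"
    using assms unfolding C1_near_def eventually_nhds_metric by (auto simp: dist_commute)
  obtain d2 where d2: "d2 > 0" "\<And>x. x \<in> ball m d2 \<Longrightarrow> \<bar>deriv G x - deriv G m\<bar> < e"
    using assms e unfolding C1_near_def continuous_at_eps_delta by (auto simp: dist_norm abs_minus_commute)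
  let ?d = "min d1 d2"
  have "norm (G x - G y - deriv G m * (x - y)) \<le> e * norm (x - y)"
    if "x \<in> ball m ?d" "y \<in> ball m ?d" for x y
  proof -
    have "norm ((\<lambda>z. G z - deriv G m * z) x - (\<lambda>z. G z - deriv G m * z) y) \<le> e * norm (x - y)"
    proof (rule field_differentiable_bound[OF convex_ball _ _ that])
      fix z assume z: "z \<in> ball m ?d"
      have der: "(G has_field_derivative deriv G z) (at z)"
        using d1(2)[of z] z by (simp add: DERIV_deriv_iff_real_differentiable)
      show "((\<lambda>z. G z - deriv G m * z) has_field_derivative (deriv G z - deriv G m)) (at z within ball m ?d)"
        by (rule has_field_derivative_at_within[OF DERIV_diff[OF der DERIV_cmult_Id]])
      show "norm (deriv G z - deriv G m) \<le> e"
        using d2(2)[of z] z by simp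
    qed
    then show ?thesis by (simp add: algebra_simps)
  qed
  then show "\<exists>\<delta>>0. \<forall>x\<in>ball m \<delta>. \<forall>y\<in>ball m \<delta>. norm (G x - G y - deriv G m * (x - y)) \<le> e * norm (x - y)"
    using d1(1) d2(1) by (intro exI[of _ ?d]) auto
qed

text \<open>The linearisation of \<open>G\<close> between \<open>H x\<close> and \<open>H y\<close>
  is read backwards. A first use, absorbing the error into the left side, shows that
  \<open>H\<close> is Lipschitz near \<open>p\<close>; a second converts the error of
  \<open>G\<close> into one of \<open>H\<close>.\<close>

lemma strict_derivative_inverse:
  fixes G H :: "real \<Rightarrow> real"
  assumes G: "strict_derivative G (\<lambda>x. c * x) (H p)" and c: "c > 0"
    and inv: "\<forall>\<^sub>F x in nhds p. G (H x) = x" and cont: "isCont H p"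
  shows "strict_derivative H (\<lambda>x. x / c) p"
proof (rule strict_derivativeI)
  show "bounded_linear (\<lambda>x. x / c)" by (rule bounded_linear_divide)
  fix e :: real assume e: "e > 0"
  \<comment> \<open>\<open>c / 2\<close> allows the absorption, with Lipschitz constant
    \<open>2 / c\<close> for \<open>H\<close>. The final error is then
    \<open>2 * k / c\<^sup>2\<close> times the distance, which the second bound brings down to
    \<open>e\<close>.\<close>
  define k where "k = min (c / 2) (e * c\<^sup>2 / 2)"
  have k: "k > 0" "k \<le> c / 2" "k \<le> e * c\<^sup>2 / 2" using e c by (auto simp: k_def)
  obtain d where d: "d > 0" "\<And>x y. x \<in> ball (H p) d \<Longrightarrow> y \<in> ball (H p) d \<Longrightarrow>
      norm (G x - G y - c * (x - y)) \<le> k * norm (x - y)"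
    using G k(1) unfolding strict_derivative_def by meson
  have "\<forall>\<^sub>F x in nhds p. dist (H x) (H p) < d"
    using cont d(1) by (metis continuous_at_eps_delta eventually_nhds_metric)
  with inv have "\<forall>\<^sub>F x in nhds p. G (H x) = x \<and> H x \<in> ball (H p) d"
    by eventually_elim (simp add: dist_commute)
  then obtain r where r: "r > 0" "\<And>x. x \<in> ball p r \<Longrightarrow> G (H x) = x \<and> H x \<in> ball (H p) d"
    unfolding eventually_nhds_metric by (auto simp: dist_commute)
  have "norm (H x - H y - (x - y) / c) \<le> e * norm (x - y)" if "x \<in> ball p r" "y \<in> ball p r" for x y
  proof -
    let ?h = "H x - H y"
    have G_le: "\<bar>(x - y) - c * ?h\<bar> \<le> k * \<bar>?h\<bar>"
      using d(2)[of "H x" "H y"] r(2)[OF that(1)] r(2)[OF that(2)] by simp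
    have "c * \<bar>?h\<bar> = \<bar>c * ?h\<bar>"
      using c by (simp add: abs_mult)
    also have "\<dots> \<le> \<bar>x - y\<bar> + k * \<bar>?h\<bar>"
      using G_le by linarith
    also have "\<dots> \<le> \<bar>x - y\<bar> + c / 2 * \<bar>?h\<bar>"
      by (intro add_left_mono mult_right_mono k) auto
    finally have h: "\<bar>?h\<bar> \<le> 2 / c * \<bar>x - y\<bar>"
      using c by (simp add: field_simps)
    have "\<bar>?h - (x - y) / c\<bar> = \<bar>(x - y) - c * ?h\<bar> / c"
    proof -
      have "?h - (x - y) / c = - (((x - y) - c * ?h) / c)"
        using c by (simp add: diff_divide_distrib)
      then show ?thesis using c by simp
    qed
    also have "\<dots> \<le> (k * (2 / c * \<bar>x - y\<bar>)) / c"
      using c k(1) by (intro divide_right_mono order_trans[OF G_le] mult_left_mono h) auto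
    also have "\<dots> \<le> (e * c\<^sup>2 / 2 * (2 / c * \<bar>x - y\<bar>)) / c"
      using c by (intro divide_right_mono mult_right_mono k) auto
    also have "\<dots> = e * \<bar>x - y\<bar>"
      using c by (simp add: power2_eq_square)
    finally show ?thesis by simp
  qed
  then show "\<exists>\<delta>>0. \<forall>x\<in>ball p \<delta>. \<forall>y\<in>ball p \<delta>. norm (H x - H y - (x - y) / c) \<le> e * norm (x - y)"
    using r(1) by blast
qed

subsection \<open>Consistency under a strict derivative\<close>

text \<open>Image measures commute with products. It serves three changes of sampling space: from
  levels u to quantiles, from data to transforms, and from indices to data.\<close>

lemma distr_PiM_sum:
  fixes g :: "real \<Rightarrow> 'b::euclidean_space" and \<psi> :: "'b \<Rightarrow> 'c::euclidean_space" and n :: nat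
  assumes "prob_space N" and [measurable]: "f \<in> borel_measurable N" "g \<in> borel_measurable borel"
    "\<psi> \<in> borel_measurable borel"
  shows "distr (\<Pi>\<^sub>M i\<in>{..<n}. N) borel (\<lambda>y. \<psi> (\<Sum>i<n. g (f (y i))))
    = distr (\<Pi>\<^sub>M i\<in>{..<n}. distr N borel f) borel (\<lambda>y. \<psi> (\<Sum>i<n. g (y i)))"
proof -
  interpret prob_space N by fact
  interpret D: prob_space "distr N borel f" by (rule prob_space_distr) simp
  \<comment> \<open>\<open>compose\<close> restricts the result to \<open>{..<n}\<close>, as
    extensionality of the product space demands.\<close>
  have eq: "(\<Pi>\<^sub>M i\<in>{..<n}. distr N borel f)
      = distr (\<Pi>\<^sub>M i\<in>{..<n}. N) (\<Pi>\<^sub>M i\<in>{..<n}. distr N borel f) (compose {..<n} f)"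
  proof -
    have "(\<Pi>\<^sub>M i\<in>{..<n}. distr N (distr N borel f) f) = (\<Pi>\<^sub>M i\<in>{..<n}. distr N borel f)"
      by (intro PiM_cong refl distr_cong) auto
    then show ?thesis
      using prob_space_axioms D.prob_space_axioms
      by (subst distr_PiM_finite_prob_space') auto
  qed
  have m: "compose {..<n} f \<in> (\<Pi>\<^sub>M i\<in>{..<n}. N) \<rightarrow>\<^sub>M (\<Pi>\<^sub>M i\<in>{..<n}. distr N borel f)"
    unfolding compose_def by measurable
  have "distr (\<Pi>\<^sub>M i\<in>{..<n}. distr N borel f) borel (\<lambda>y. \<psi> (\<Sum>i<n. g (y i)))
      = distr (distr (\<Pi>\<^sub>M i\<in>{..<n}. N) (\<Pi>\<^sub>M i\<in>{..<n}. distr N borel f) (compose {..<n} f)) borel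
          (\<lambda>y. \<psi> (\<Sum>i<n. g (y i)))"
    using eq by (rule arg_cong)
  also have "\<dots> = distr (\<Pi>\<^sub>M i\<in>{..<n}. N) borel (\<lambda>y. \<psi> (\<Sum>i<n. g (compose {..<n} f y i)))"
    by (subst distr_distr[OF _ m]) (simp_all add: comp_def)
  also have "\<dots> = distr (\<Pi>\<^sub>M i\<in>{..<n}. N) borel (\<lambda>y. \<psi> (\<Sum>i<n. g (f (y i))))"
    by (simp add: compose_def)
  finally show ?thesis ..
qed

lemma (in prob_space) distr_sum_indep:
  fixes g :: "real \<Rightarrow> 'b::euclidean_space" and \<psi> :: "'b \<Rightarrow> 'c::euclidean_space"
  assumes n: "0 < n" and indep: "indep_vars (\<lambda>_. borel) Y {..<n}"
    and dist: "\<And>i. i < n \<Longrightarrow> distr M borel (Y i) = \<nu>"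
    and [measurable]: "g \<in> borel_measurable borel" "\<psi> \<in> borel_measurable borel"
  shows "distr M borel (\<lambda>\<omega>. \<psi> (\<Sum>i<n. g (Y i \<omega>))) = distr (\<Pi>\<^sub>M i\<in>{..<n}. \<nu>) borel (\<lambda>y. \<psi> (\<Sum>i<n. g (y i)))"
proof -
  have [measurable]: "Y i \<in> borel_measurable M" if "i < n" for i
    using indep that by (auto simp: indep_vars_def)
  have "distr M (\<Pi>\<^sub>M i\<in>{..<n}. borel) (\<lambda>\<omega>. \<lambda>i\<in>{..<n}. Y i \<omega>) = (\<Pi>\<^sub>M i\<in>{..<n}. distr M borel (Y i))"
    using indep n by (subst (asm) indep_vars_iff_distr_eq_PiM') auto
  also have "\<dots> = (\<Pi>\<^sub>M i\<in>{..<n}. \<nu>)"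
    using dist by (intro PiM_cong) auto
  finally have eq: "(\<Pi>\<^sub>M i\<in>{..<n}. \<nu>) = distr M (\<Pi>\<^sub>M i\<in>{..<n}. borel) (\<lambda>\<omega>. \<lambda>i\<in>{..<n}. Y i \<omega>)" ..
  show ?thesis
    unfolding eq by (subst distr_distr) (auto simp: comp_def)
qed

lemma abs_integral_le_1:
  fixes h :: "'a \<Rightarrow> real"
  assumes "prob_space \<mu>" "\<And>x. \<bar>h x\<bar> \<le> 1"
  shows "\<bar>\<integral>x. h x \<partial>\<mu>\<bar> \<le> 1"
proof (cases "integrable \<mu> h")
  case True
  interpret prob_space \<mu> by fact
  have "\<bar>\<integral>x. h x \<partial>\<mu>\<bar> \<le> (\<integral>x. \<bar>h x\<bar> \<partial>\<mu>)" by (rule integral_abs_bound)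
  also have "\<dots> \<le> 1" using True assms(2) by (intro integral_le_const) auto
  finally show ?thesis .
qed (simp add: not_integrable_integral_eq)

lemma BL_dist_nonneg:
  assumes "prob_space \<mu>" "prob_space \<nu>"
  shows "0 \<le> BL_dist \<mu> \<nu>"
proof -
  let ?H = "{h :: real ^ 'a \<Rightarrow> real. (\<forall>x. \<bar>h x\<bar> \<le> 1) \<and> 1-lipschitz_on UNIV h}"
  have "bdd_above ((\<lambda>h. \<bar>(\<integral>x. h x \<partial>\<mu>) - (\<integral>x. h x \<partial>\<nu>)\<bar>) ` ?H)"
  proof (rule bdd_aboveI2)
    fix h assume "h \<in> ?H"
    then show "\<bar>(\<integral>x. h x \<partial>\<mu>) - (\<integral>x. h x \<partial>\<nu>)\<bar> \<le> 2"
      using abs_integral_le_1[OF assms(1), of h] abs_integral_le_1[OF assms(2), of h] by auto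
  qed
  moreover have "(\<lambda>_. 0) \<in> ?H" by (auto simp: lipschitz_on_def)
  ultimately show ?thesis
    unfolding BL_dist_def by (rule cSUP_upper2) simp_all
qed

text \<open>The bootstrap sample is generated by drawing indices, under a product measure that does
  not see the data. The data enter only through the finitely many points
  \<open>z f \<omega>\<close>, which are measurable in \<omega>.\<close>

lemma borel_measurable_BL_dist_bootstrap:
  fixes \<phi> :: "'b::euclidean_space \<Rightarrow> real ^ 'k::finite" and g :: "real \<Rightarrow> 'b"
  assumes X[measurable]: "\<And>i. X i \<in> borel_measurable M"
    and [measurable]: "g \<in> borel_measurable borel" "\<phi> \<in> borel_measurable borel"
    and \<nu>: "prob_space \<nu>"
  shows "(\<lambda>\<omega>. BL_dist (bootstrap_law (\<lambda>n x. \<phi> ((\<Sum>i<n. g (x i)) /\<^sub>R n)) n (\<lambda>i. X i \<omega>)) \<nu>) \<in> borel_measurable M"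
proof (cases "n = 0")
  case True
  \<comment> \<open>For \<open>n = 0\<close> the empirical distribution is meaningless, but the
    empty product ignores its factors and \<open>sqrt 0\<close> annihilates the statistic, so the
    law is the same for all data.\<close>
  have "bootstrap_law (\<lambda>n x. \<phi> ((\<Sum>i<n. g (x i)) /\<^sub>R n)) 0 x
      = distr (\<Pi>\<^sub>M i\<in>{..<0::nat}. (borel :: real measure)) borel (\<lambda>_. 0)" for x
  proof -
    have "(\<Pi>\<^sub>M i\<in>{..<0}. empirical 0 x) = (\<Pi>\<^sub>M i\<in>{..<0::nat}. borel)"
      by (rule PiM_cong) auto
    then show ?thesis by (simp add: bootstrap_law_def)
  qed
  then show ?thesis using True by simp
next
  case False
  define p where "p = pmf_of_set {..<n}"
  have p: "set_pmf p = {..<n}" using False unfolding p_def by (intro set_pmf_of_set) auto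
  let ?R = "\<Pi>\<^sub>M i\<in>{..<n}. measure_pmf p"
  interpret R: prob_space ?R by (intro prob_space_PiM measure_pmf.prob_space_axioms)
  let ?H = "{h :: real ^ 'k \<Rightarrow> real. (\<forall>x. \<bar>h x\<bar> \<le> 1) \<and> 1-lipschitz_on UNIV h}"
  define z where "z f \<omega> = sqrt n *\<^sub>R (\<phi> ((\<Sum>i<n. g (X (f i) \<omega>)) /\<^sub>R n) - \<phi> ((\<Sum>i<n. g (X i \<omega>)) /\<^sub>R n))"
    for f :: "nat \<Rightarrow> nat" and \<omega>
  let ?F = "{..<n} \<rightarrow>\<^sub>E {..<n}"
  have law: "bootstrap_law (\<lambda>n x. \<phi> ((\<Sum>i<n. g (x i)) /\<^sub>R n)) n (\<lambda>i. X i \<omega>) = distr ?R borel (\<lambda>f. z f \<omega>)" for \<omega>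
    unfolding bootstrap_law_def empirical_def p_def[symmetric] z_def
    by (rule distr_PiM_sum[symmetric, where \<psi> = "\<lambda>s. sqrt n *\<^sub>R (\<phi> (s /\<^sub>R n) - \<phi> ((\<Sum>i<n. g (X i \<omega>)) /\<^sub>R n))"])
      (auto intro: measure_pmf.prob_space_axioms)
  have meas_z: "(\<lambda>f. z f \<omega>) \<in> borel_measurable ?R" for \<omega>
  proof -
    have [measurable]: "(\<lambda>j. g (X j \<omega>)) \<in> borel_measurable (measure_pmf p)" for \<omega> by simp
    show ?thesis unfolding z_def by measurable
  qed
  have int: "(\<integral>x. h x \<partial>distr ?R borel (\<lambda>f. z f \<omega>)) = (\<Sum>f\<in>?F. measure ?R {f} * h (z f \<omega>))" if "h \<in> ?H" for h \<omega>
  proof -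
    have "continuous_on UNIV h" using that by (auto intro: lipschitz_on_continuous_on)
    then have [measurable]: "h \<in> borel_measurable borel" by (rule borel_measurable_continuous_onI)
    have "(\<integral>x. h x \<partial>distr ?R borel (\<lambda>f. z f \<omega>)) = (\<integral>f. h (z f \<omega>) \<partial>?R)"
      using meas_z by (intro integral_distr) auto
    also have "\<dots> = (\<Sum>f\<in>?F. measure ?R {f} * h (z f \<omega>))"
      using meas_z[of \<omega>] by (subst integral_PiM_pmf_eq_sum) (auto simp: p)
    finally show ?thesis .
  qed
  have "(\<lambda>\<omega>. SUP h\<in>?H. \<bar>(\<Sum>f\<in>?F. measure ?R {f} * h (z f \<omega>)) - (\<integral>x. h x \<partial>\<nu>)\<bar>) \<in> borel_measurable M"
  proof (rule borel_measurable_SUP_BL)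
    show "z f \<in> borel_measurable M" for f
      unfolding z_def[abs_def] by measurable
    show "\<bar>\<integral>x. h x \<partial>\<nu>\<bar> \<le> 1" if "h \<in> ?H" for h
      using that by (intro abs_integral_le_1 \<nu>) auto
  qed (auto intro: finite_PiE)
  moreover have "BL_dist (distr ?R borel (\<lambda>f. z f \<omega>)) \<nu>
      = (SUP h\<in>?H. \<bar>(\<Sum>f\<in>?F. measure ?R {f} * h (z f \<omega>)) - (\<integral>x. h x \<partial>\<nu>)\<bar>)" for \<omega>
    unfolding BL_dist_def by (intro SUP_cong refl) (simp only: int)
  ultimately show ?thesis
    unfolding law by simp
qed

text \<open>A deterministic bound for fixed data \<open>u\<close>: the quantile coupling is inserted
  into the estimate for coupled averages. Randomness remains only in the two conditions on
  \<open>u\<close>, closeness of the sample mean and a bound \<open>w\<close> on the area.\<close>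

lemma BL_dist_bootstrap_law_le:
  fixes g :: "real \<Rightarrow> 'b::euclidean_space" and \<phi> :: "'b \<Rightarrow> real ^ 'k::finite"
    and n :: nat and C \<delta> e \<eta> \<Lambda> \<kappa> w :: real
  assumes n: "0 < n" and \<nu>: "real_distribution \<nu>" "measure \<nu> {0..1} = 1"
    and u: "\<And>i. i < n \<Longrightarrow> u i \<in> {0..1}"
    and [measurable]: "g \<in> borel_measurable borel" "\<phi> \<in> borel_measurable borel"
    and bounded: "\<And>x. x \<in> {0..1} \<Longrightarrow> norm (g x) \<le> C"
    and lipschitz: "\<And>x y. x \<in> {0..1} \<Longrightarrow> y \<in> {0..1} \<Longrightarrow> norm (g x - g y) \<le> \<kappa> * \<bar>x - y\<bar>"
    and L: "bounded_linear L" "\<And>x. norm (L x) \<le> \<Lambda> * norm x" and \<Lambda>: "0 \<le> \<Lambda>"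
    and strict: "\<And>x y. x \<in> ball (\<integral>x. g x \<partial>\<nu>) \<delta> \<Longrightarrow> y \<in> ball (\<integral>x. g x \<partial>\<nu>) \<delta> \<Longrightarrow>
        norm (\<phi> x - \<phi> y - L (x - y)) \<le> e * norm (x - y)"
    and \<delta>: "0 < \<delta>" and e: "0 \<le> e" and \<eta>: "0 < \<eta>"
    and close: "norm ((\<Sum>i<n. g (u i)) /\<^sub>R n - (\<integral>x. g x \<partial>\<nu>)) < \<delta> / 2"
    and w: "0 \<le> w" "(\<integral>\<^sup>+t\<in>{0..1}. ennreal \<bar>cdf (empirical n u) t - cdf \<nu> t\<bar> \<partial>lborel) \<le> ennreal w"
  defines "law \<equiv> \<lambda>\<mu>. distr (\<Pi>\<^sub>M i\<in>{..<n}. \<mu>) borel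
      (\<lambda>y. sqrt n *\<^sub>R (\<phi> ((\<Sum>i<n. g (y i)) /\<^sub>R n) - \<phi> (\<integral>x. g x \<partial>\<mu>)))"
  shows "BL_dist (law (empirical n u)) (law \<nu>)
    \<le> 16 * C\<^sup>2 / (n * \<delta>\<^sup>2) + 2 * e * (1 + C\<^sup>2) + \<Lambda> * (\<eta> + \<kappa>\<^sup>2 * w / \<eta>)"
proof -
  let ?K = uniform01
  interpret K: prob_space ?K by (rule prob_space_uniform01)
  have emp01: "measure (empirical n u) {0..1} = 1"
  proof -
    have "measure (empirical n u) {0..1} = (\<integral>x. indicator {0..1} x \<partial>empirical n u)"
      using real_distribution.space_eq_univ[OF real_distribution_empirical[OF n]] by simp
    also have "\<dots> = 1"
      using n u by (subst integral_empirical) auto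
    finally show ?thesis .
  qed
  obtain A B where AB[measurable]: "A \<in> borel_measurable ?K" "B \<in> borel_measurable ?K"
    and distr: "distr ?K borel A = empirical n u" "distr ?K borel B = \<nu>"
    and range: "\<And>x. x \<in> space ?K \<Longrightarrow> A x \<in> {0..1}" "\<And>x. x \<in> space ?K \<Longrightarrow> B x \<in> {0..1}"
    and dist: "(\<integral>\<^sup>+x. ennreal \<bar>A x - B x\<bar> \<partial>?K)
      = (\<integral>\<^sup>+t\<in>{0..1}. ennreal \<bar>cdf (empirical n u) t - cdf \<nu> t\<bar> \<partial>lborel)"
    by (rule quantile_coupling[OF real_distribution_empirical[OF n, of u] \<nu>(1) emp01 \<nu>(2)]) (rule that; assumption)
  have int_g: "(\<integral>x. g (f x) \<partial>?K) = (\<integral>x. g x \<partial>distr ?K borel f)" if "f \<in> borel_measurable ?K" for f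
    using that by (subst integral_distr) auto
  have law: "law (distr ?K borel f) = distr (\<Pi>\<^sub>M i\<in>{..<n}. ?K) borel
      (\<lambda>\<omega>. sqrt n *\<^sub>R (\<phi> ((\<Sum>i<n. g (f (\<omega> i))) /\<^sub>R n) - \<phi> (\<integral>\<omega>. g (f \<omega>) \<partial>?K)))"
    if "f \<in> borel_measurable ?K" for f
    unfolding law_def int_g[OF that]
    by (rule distr_PiM_sum[symmetric, where \<psi> = "\<lambda>s. sqrt n *\<^sub>R (\<phi> (s /\<^sub>R n) - \<phi> (\<integral>x. g x \<partial>distr ?K borel f))"])
      (use that K.prob_space_axioms in auto)
  have \<nu>_mean: "(\<integral>\<omega>. g (B \<omega>) \<partial>?K) = (\<integral>x. g x \<partial>\<nu>)"
    by (simp add: int_g distr)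
  have mean: "(\<integral>\<omega>. g (A \<omega>) \<partial>?K) = (\<Sum>i<n. g (u i)) /\<^sub>R n"
    by (simp add: int_g distr integral_empirical[OF n])
  have "(\<integral>\<omega>. (norm (g (A \<omega>) - g (B \<omega>)))\<^sup>2 \<partial>?K) \<le> (\<integral>\<omega>. \<kappa>\<^sup>2 * \<bar>A \<omega> - B \<omega>\<bar> \<partial>?K)"
  proof (rule integral_mono)
    have range': "\<bar>A \<omega> - B \<omega>\<bar> \<le> 1" if "\<omega> \<in> space ?K" for \<omega>
      using range[OF that] by auto
    have sq: "(norm (g (A \<omega>) - g (B \<omega>)))\<^sup>2 \<le> \<kappa>\<^sup>2 * \<bar>A \<omega> - B \<omega>\<bar>" if "\<omega> \<in> space ?K" for \<omega>
    proof -
      have "(norm (g (A \<omega>) - g (B \<omega>)))\<^sup>2 \<le> (\<kappa> * \<bar>A \<omega> - B \<omega>\<bar>)\<^sup>2"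
        using range[OF that] by (intro power_mono lipschitz) auto
      also have "\<dots> = \<kappa>\<^sup>2 * (\<bar>A \<omega> - B \<omega>\<bar> * \<bar>A \<omega> - B \<omega>\<bar>)"
        by (simp add: power_mult_distrib power2_eq_square)
      \<comment> \<open>Both quantiles lie in [0, 1]; one factor of the square is given away so that
        the area between the distribution functions bounds the second moment.\<close>
      also have "\<dots> \<le> \<kappa>\<^sup>2 * (\<bar>A \<omega> - B \<omega>\<bar> * 1)"
        using range'[OF that] by (intro mult_left_mono) auto
      finally show ?thesis by simp
    qed
    then show "(norm (g (A \<omega>) - g (B \<omega>)))\<^sup>2 \<le> \<kappa>\<^sup>2 * \<bar>A \<omega> - B \<omega>\<bar>" if "\<omega> \<in> space ?K" for \<omega>
      using that by blast
    have le: "\<kappa>\<^sup>2 * \<bar>A \<omega> - B \<omega>\<bar> \<le> \<kappa>\<^sup>2" if "\<omega> \<in> space ?K" for \<omega>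
      using range'[OF that] mult_left_mono[of "\<bar>A \<omega> - B \<omega>\<bar>" 1 "\<kappa>\<^sup>2"] by simp
    show "integrable ?K (\<lambda>\<omega>. \<kappa>\<^sup>2 * \<bar>A \<omega> - B \<omega>\<bar>)"
      by (rule K.integrable_bounded[where C = "\<kappa>\<^sup>2"]) (use le in \<open>auto simp: abs_mult\<close>)
    show "integrable ?K (\<lambda>\<omega>. (norm (g (A \<omega>) - g (B \<omega>)))\<^sup>2)"
      by (rule K.integrable_bounded[where C = "\<kappa>\<^sup>2"]) (use order_trans[OF sq le] in auto)
  qed
  also have "\<dots> = \<kappa>\<^sup>2 * enn2real (\<integral>\<^sup>+x. ennreal \<bar>A x - B x\<bar> \<partial>?K)"
    by (simp add: integral_eq_nn_integral)
  also have "\<dots> \<le> \<kappa>\<^sup>2 * w"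
    using w dist by (intro mult_left_mono) (auto intro: enn2real_leI)
  finally have sq_le: "(\<integral>\<omega>. (norm (g (A \<omega>) - g (B \<omega>)))\<^sup>2 \<partial>?K) \<le> \<kappa>\<^sup>2 * w" .
  have "BL_dist (law (distr ?K borel A)) (law (distr ?K borel B))
      \<le> 16 * C\<^sup>2 / (n * \<delta>\<^sup>2) + 2 * e * (1 + C\<^sup>2)
        + \<Lambda> * (\<eta> + (\<integral>\<omega>. (norm (g (A \<omega>) - g (B \<omega>)))\<^sup>2 \<partial>?K) / \<eta>)"
    unfolding law[OF AB(1)] law[OF AB(2)]
    by (rule BL_dist_average_coupling_le[OF K.prob_space_axioms n _ _ _ _ _ L \<Lambda> _ \<delta> e \<eta>])
      (use bounded range strict close in \<open>auto simp: \<nu>_mean mean\<close>)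
  also have "\<dots> \<le> 16 * C\<^sup>2 / (n * \<delta>\<^sup>2) + 2 * e * (1 + C\<^sup>2) + \<Lambda> * (\<eta> + \<kappa>\<^sup>2 * w / \<eta>)"
    using sq_le \<Lambda> \<eta> by (intro add_mono mult_left_mono divide_right_mono order_refl) auto
  finally show ?thesis
    unfolding distr .
qed

text \<open>The deterministic bound makes the distance at most \<epsilon> unless the sample mean or
  the area \<open>W\<close> is large, and both exceptional probabilities vanish by Markov's
  inequality. The tolerances are chosen before \<open>n\<close>.\<close>

lemma bootstrap_consistent_strict_derivative:
  fixes g :: "real \<Rightarrow> 'b::euclidean_space" and \<phi> :: "'b \<Rightarrow> real ^ 'k::finite" and \<kappa> :: real
  assumes M: "prob_space M" and indep: "prob_space.indep_vars M (\<lambda>_. borel) X UNIV"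
    and dist: "\<And>i. distr M borel (X i) = P"
    and U[measurable]: "U \<in> borel_measurable borel" and U01: "\<And>x. U x \<in> {0..1}"
    and [measurable]: "g \<in> borel_measurable borel" "\<phi> \<in> borel_measurable borel"
    and lipschitz: "\<And>x y. x \<in> {0..1} \<Longrightarrow> y \<in> {0..1} \<Longrightarrow> norm (g x - g y) \<le> \<kappa> * \<bar>x - y\<bar>"
    and deriv: "strict_derivative \<phi> L (\<integral>x. g (U x) \<partial>P)"
  shows "bootstrap_consistent M X (\<lambda>n x. \<phi> ((\<Sum>i<n. g (U (x i))) /\<^sub>R n)) (\<phi> (\<integral>x. g (U x) \<partial>P))"
proof -
  interpret M: prob_space M by fact
  have X[measurable]: "X i \<in> borel_measurable M" for i
    using indep by (simp add: M.indep_vars_def)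
  define Y where "Y i \<omega> = U (X i \<omega>)" for i \<omega>
  define \<nu> where "\<nu> = distr P borel U"
  have P_sets[measurable_cong]: "sets P = sets borel" using dist[of 0] by auto
  have Y_dist: "distr M borel (Y i) = \<nu>" for i
    unfolding \<nu>_def dist[of i, symmetric] Y_def[abs_def] by (subst distr_distr) (auto simp: comp_def)
  have Y_meas[measurable]: "Y i \<in> borel_measurable M" for i
    unfolding Y_def[abs_def] by measurable
  have Y_indep: "M.indep_vars (\<lambda>_. borel) Y {..<n}" for n
    unfolding Y_def[abs_def]
    by (rule M.indep_vars_compose2[OF M.indep_vars_subset[OF indep]]) auto
  have Y01: "Y i \<omega> \<in> {0..1}" for i \<omega> using U01 by (simp add: Y_def)
  have \<nu>: "real_distribution \<nu>"
    unfolding Y_dist[of 0, symmetric] by (rule M.real_distribution_distr) simp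
  interpret \<nu>: real_distribution \<nu> by (rule \<nu>)
  have "measure \<nu> {0..1} = measure M (space M)"
    unfolding Y_dist[of 0, symmetric] using Y01
    by (subst measure_distr) (auto intro!: arg_cong[where f = "measure M"])
  then have \<nu>01: "measure \<nu> {0..1} = 1" by (simp add: M.prob_space)
  define p where "p = (\<integral>x. g x \<partial>\<nu>)"
  have p: "(\<integral>x. g (U x) \<partial>P) = p"
    unfolding p_def \<nu>_def by (subst integral_distr) auto
  \<comment> \<open>A Lipschitz map on [0, 1] differs from its value at 0 by at most its
    constant.\<close>
  define C where "C = norm (g 0) + \<bar>\<kappa>\<bar>"
  have bounded: "norm (g x) \<le> C" if "x \<in> {0..1}" for x
  proof -
    have "norm (g x) \<le> norm (g 0) + norm (g x - g 0)"
      by (metis norm_triangle_sub)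
    also have "norm (g x - g 0) \<le> \<kappa> * \<bar>x - 0\<bar>"
      using that by (intro lipschitz) auto
    also have "\<kappa> * \<bar>x - 0\<bar> \<le> \<bar>\<kappa>\<bar> * 1"
      using that by (intro mult_mono) auto
    finally show ?thesis by (simp add: C_def)
  qed
  define D where "D n \<omega> = BL_dist (bootstrap_law (\<lambda>n x. \<phi> ((\<Sum>i<n. g (U (x i))) /\<^sub>R n)) n (\<lambda>i. X i \<omega>))
      (error_law M X (\<lambda>n x. \<phi> ((\<Sum>i<n. g (U (x i))) /\<^sub>R n)) (\<phi> p) n)" for n \<omega>
  have error_prob: "prob_space (error_law M X (\<lambda>n x. \<phi> ((\<Sum>i<n. g (U (x i))) /\<^sub>R n)) (\<phi> p) n)" for n
    unfolding error_law_def by (rule M.prob_space_distr) measurable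
  have D_meas: "D n \<in> borel_measurable M" for n
    unfolding D_def
    using borel_measurable_BL_dist_bootstrap[OF X, where g = "\<lambda>x. g (U x)", OF _ _ error_prob] by simp
  \<comment> \<open>One functional of the sampling measure covers both laws: at the empirical
    measure the integral of \<open>g\<close> is the sample mean, which is precisely the bootstrap
    centring.\<close>
  define law where "law n \<mu> = distr (\<Pi>\<^sub>M i\<in>{..<n}. \<mu>) borel
      (\<lambda>y. sqrt (real n) *\<^sub>R (\<phi> ((\<Sum>i<n. g (y i)) /\<^sub>R n) - \<phi> (\<integral>x. g x \<partial>\<mu>)))" for n \<mu>
  have D_eq: "D n \<omega> = BL_dist (law n (empirical n (\<lambda>i. Y i \<omega>))) (law n \<nu>)" if n: "0 < n" for n \<omega>
  proof -
    have "bootstrap_law (\<lambda>n x. \<phi> ((\<Sum>i<n. g (U (x i))) /\<^sub>R n)) n (\<lambda>i. X i \<omega>) = law n (empirical n (\<lambda>i. Y i \<omega>))"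
    proof -
      interpret E: real_distribution "empirical n (\<lambda>i. X i \<omega>)" by (rule real_distribution_empirical[OF n])
      have mean: "(\<integral>x. g x \<partial>empirical n (\<lambda>i. Y i \<omega>)) = (\<Sum>i<n. g (U (X i \<omega>))) /\<^sub>R n"
        by (simp add: integral_empirical[OF n] Y_def)
      have emp: "empirical n (\<lambda>i. Y i \<omega>) = distr (empirical n (\<lambda>i. X i \<omega>)) borel U"
        unfolding Y_def by (rule distr_empirical[symmetric]) simp
      show ?thesis
        unfolding law_def bootstrap_law_def mean unfolding emp
        by (rule distr_PiM_sum[where \<psi> = "\<lambda>s. sqrt n *\<^sub>R (\<phi> (s /\<^sub>R n) - \<phi> ((\<Sum>i<n. g (U (X i \<omega>))) /\<^sub>R n))"])
          (use E.prob_space_axioms in auto)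
    qed
    moreover have "error_law M X (\<lambda>n x. \<phi> ((\<Sum>i<n. g (U (x i))) /\<^sub>R n)) (\<phi> p) n = law n \<nu>"
      unfolding error_law_def law_def p_def[symmetric] Y_def[symmetric]
      by (rule M.distr_sum_indep[OF n Y_indep Y_dist, where \<psi> = "\<lambda>s. sqrt n *\<^sub>R (\<phi> (s /\<^sub>R n) - \<phi> p)"]) auto
    ultimately show ?thesis by (simp add: D_def)
  qed
  have D_nonneg: "0 \<le> D n \<omega>" if n: "0 < n" for n \<omega>
  proof -
    have "prob_space (law n \<mu>)" if "real_distribution \<mu>" for \<mu>
    proof -
      interpret \<mu>: real_distribution \<mu> by fact
      interpret prob_space "\<Pi>\<^sub>M i\<in>{..<n}. \<mu>" by (intro prob_space_PiM \<mu>.prob_space_axioms)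
      show ?thesis unfolding law_def by (rule prob_space_distr) measurable
    qed
    then show ?thesis
      unfolding D_eq[OF n] using \<nu> real_distribution_empirical[OF n] by (intro BL_dist_nonneg) auto
  qed
  define W where "W n \<omega> = (\<integral>\<^sup>+t\<in>{0..1::real}. ennreal \<bar>cdf (empirical n (\<lambda>i. Y i \<omega>)) t - cdf \<nu> t\<bar> \<partial>lborel)"
    for n \<omega>
  note W = M.nn_integral_cdf_empirical_diff_le[OF _ Y_indep Y_dist, folded W_def]
  define S where "S n \<omega> = (\<Sum>i<n. g (Y i \<omega>)) /\<^sub>R n" for n \<omega>
  have S_meas[measurable]: "S n \<in> borel_measurable M" for n
    unfolding S_def[abs_def] by measurable
  have S_prob: "measure M {\<omega> \<in> space M. r \<le> norm (S n \<omega> - p)} \<le> C\<^sup>2 / (n * r\<^sup>2)" if n: "0 < n" and r: "0 < r" for n r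
  proof -
    define Z where "Z \<omega> = sqrt n *\<^sub>R (S n \<omega> - p)" for \<omega>
    have mean: "M.expectation (\<lambda>\<omega>. g (Y i \<omega>)) = p" for i
      unfolding p_def Y_dist[of i, symmetric] by (subst integral_distr) auto
    have second: "M.expectation (\<lambda>\<omega>. (norm (g (Y i \<omega>)))\<^sup>2) \<le> C\<^sup>2" for i
      using bounded[OF Y01]
      by (intro M.integral_le_const M.integrable_bounded[where C = "C\<^sup>2"]) (auto intro!: power_mono)
    have indep_g: "M.indep_vars (\<lambda>_. borel) (\<lambda>i \<omega>. g (Y i \<omega>)) {..<n}"
      by (rule M.indep_vars_compose2[OF Y_indep]) auto
    have Z: "integrable M (\<lambda>\<omega>. (norm (Z \<omega>))\<^sup>2)" "M.expectation (\<lambda>\<omega>. (norm (Z \<omega>))\<^sup>2) \<le> C\<^sup>2"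
      unfolding Z_def S_def
      by (rule M.expectation_sq_norm_average_le[OF n indep_g]; use bounded[OF Y01] mean second in blast)+
    have "{\<omega> \<in> space M. r \<le> norm (S n \<omega> - p)} = {\<omega> \<in> space M. n * r\<^sup>2 \<le> (norm (Z \<omega>))\<^sup>2}"
    proof -
      have "r \<le> norm (S n \<omega> - p) \<longleftrightarrow> n * r\<^sup>2 \<le> (norm (Z \<omega>))\<^sup>2" for \<omega>
        unfolding Z_def norm_scaleR power_mult_distrib using n r
        by (simp add: abs_le_square_iff[symmetric])
      then show ?thesis by simp
    qed
    also have "measure M \<dots> \<le> M.expectation (\<lambda>\<omega>. (norm (Z \<omega>))\<^sup>2) / (n * r\<^sup>2)"
      using n r Z(1) by (intro integral_Markov_inequality_measure[where A = "{}"]) auto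
    also have "\<dots> \<le> C\<^sup>2 / (n * r\<^sup>2)"
      using Z(2) by (intro divide_right_mono) auto
    finally show ?thesis .
  qed
  have W_prob: "measure M {\<omega> \<in> space M. ennreal w < W n \<omega>} \<le> 2 / (w * sqrt n)" if n: "0 < n" and w: "0 < w" for n w
  proof -
    have [measurable]: "W n \<in> borel_measurable M" by (rule W(1)[OF n])
    have "emeasure M {\<omega> \<in> space M. ennreal w < W n \<omega>} \<le> emeasure M {\<omega> \<in> space M. 1 \<le> ennreal (1 / w) * W n \<omega>}"
    proof (intro emeasure_mono subsetI)
      fix \<omega> assume "\<omega> \<in> {\<omega> \<in> space M. ennreal w < W n \<omega>}"
      moreover from this have "ennreal (1 / w) * ennreal w \<le> ennreal (1 / w) * W n \<omega>"
        by (intro mult_left_mono) auto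
      ultimately show "\<omega> \<in> {\<omega> \<in> space M. 1 \<le> ennreal (1 / w) * W n \<omega>}"
        using w by (simp flip: ennreal_mult)
    qed measurable
    also have "\<dots> \<le> ennreal (1 / w) * (\<integral>\<^sup>+\<omega>. W n \<omega> * indicator (space M) \<omega> \<partial>M)"
      by (intro nn_integral_Markov_inequality[where A = "space M", THEN order_trans[rotated]] emeasure_mono) auto
    also have "\<dots> \<le> ennreal (1 / w) * ennreal (2 / sqrt n)"
    proof -
      have "(\<integral>\<^sup>+\<omega>. W n \<omega> * indicator (space M) \<omega> \<partial>M) = (\<integral>\<^sup>+\<omega>. W n \<omega> \<partial>M)"
        by (intro nn_integral_cong) simp
      then show ?thesis using W(2)[OF n] by (intro mult_left_mono) auto
    qed
    also have "\<dots> = ennreal (2 / (w * sqrt n))"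
      using w by (simp flip: ennreal_mult)
    finally show ?thesis
      using w by (simp add: M.emeasure_eq_measure)
  qed
  have "(\<lambda>n. measure M {\<omega> \<in> space M. \<bar>D n \<omega>\<bar> > \<epsilon>}) \<longlonglongrightarrow> 0" if \<epsilon>: "\<epsilon> > 0" for \<epsilon>
  proof -
    have L: "bounded_linear L" using deriv by (simp add: strict_derivative_def)
    then obtain \<Lambda> where \<Lambda>: "\<Lambda> > 0" "\<And>x. norm (L x) \<le> \<Lambda> * norm x"
      using bounded_linear.pos_bounded[OF L] by (auto simp: mult.commute)
    \<comment> \<open>Each of the three terms of the bound receives at most
      \<open>\<epsilon> / 4\<close>: \<open>e\<close> settles the linearisation errors, \<eta> and
      \<open>w\<close> the coupling term, and large \<open>n\<close> the Chebyshev term.\<close>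
    define e where "e = \<epsilon> / (8 * (1 + C\<^sup>2))"
    have "1 + C\<^sup>2 > 0" by (simp add: add_pos_nonneg)
    then have e: "e > 0" "2 * e * (1 + C\<^sup>2) = \<epsilon> / 4"
      using \<epsilon> by (auto simp: e_def field_simps)
    obtain \<delta> where \<delta>: "\<delta> > 0" "\<And>x y. x \<in> ball p \<delta> \<Longrightarrow> y \<in> ball p \<delta> \<Longrightarrow>
        norm (\<phi> x - \<phi> y - L (x - y)) \<le> e * norm (x - y)"
      using deriv e(1) unfolding p strict_derivative_def by meson
    define \<eta> where "\<eta> = \<epsilon> / (8 * \<Lambda>)"
    have \<eta>: "\<eta> > 0" "\<Lambda> * (2 * \<eta>) = \<epsilon> / 4" using \<epsilon> \<Lambda> by (auto simp: \<eta>_def)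
    \<comment> \<open>Chosen so that \<open>\<kappa>\<^sup>2 * w / \<eta>\<close> is at most \<eta>,
      which doubles \<eta> in the coupling term; the 1 covers \<open>\<kappa> = 0\<close>.\<close>
    define w where "w = \<eta>\<^sup>2 / (1 + \<kappa>\<^sup>2)"
    have "1 + \<kappa>\<^sup>2 > 0" by (simp add: add_pos_nonneg)
    then have w: "w > 0" "\<kappa>\<^sup>2 * w \<le> \<eta>\<^sup>2"
      using \<eta>(1) by (auto simp: w_def field_simps)
    have "\<kappa>\<^sup>2 * w / \<eta> \<le> \<eta>\<^sup>2 / \<eta>" using w(2) \<eta>(1) by (intro divide_right_mono) auto
    then have w\<eta>: "\<Lambda> * (\<eta> + \<kappa>\<^sup>2 * w / \<eta>) \<le> \<epsilon> / 4"
      unfolding \<eta>(2)[symmetric] using \<eta>(1) \<Lambda>(1) by (intro mult_left_mono) (auto simp: power2_eq_square)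
    have lim1: "(\<lambda>n. 16 * C\<^sup>2 / (real n * \<delta>\<^sup>2)) \<longlonglongrightarrow> 0"
      using lim_const_over_n[of "16 * C\<^sup>2 / \<delta>\<^sup>2"] by (simp add: divide_divide_eq_left mult.commute)
    have "\<forall>\<^sub>F n in sequentially. 16 * C\<^sup>2 / (real n * \<delta>\<^sup>2) < \<epsilon> / 4"
      using \<epsilon> by (intro order_tendstoD(2)[OF lim1]) simp
    then have le: "\<forall>\<^sub>F n in sequentially. measure M {\<omega> \<in> space M. \<bar>D n \<omega>\<bar> > \<epsilon>}
        \<le> C\<^sup>2 / (real n * (\<delta> / 2)\<^sup>2) + 2 / (w * sqrt (real n))"
      using eventually_gt_at_top[of 0]
    proof eventually_elim
      case (elim n)
      have [measurable]: "W n \<in> borel_measurable M" by (rule W(1)[OF elim(2)])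
      have "D n \<omega> \<le> \<epsilon>" if "norm (S n \<omega> - p) < \<delta> / 2" "W n \<omega> \<le> ennreal w" for \<omega>
      proof -
        have "D n \<omega> \<le> 16 * C\<^sup>2 / (n * \<delta>\<^sup>2) + 2 * e * (1 + C\<^sup>2) + \<Lambda> * (\<eta> + \<kappa>\<^sup>2 * w / \<eta>)"
          unfolding D_eq[OF elim(2)] law_def
          by (rule BL_dist_bootstrap_law_le[where L = L])
            (use elim \<nu> \<nu>01 Y01 bounded lipschitz L \<Lambda> \<delta> e \<eta> w that in \<open>auto simp: p_def S_def W_def\<close>)
        then show ?thesis using elim(1) e(2) w\<eta> \<epsilon> by linarith
      qed
      then have "{\<omega> \<in> space M. \<bar>D n \<omega>\<bar> > \<epsilon>}
          \<subseteq> {\<omega> \<in> space M. \<delta> / 2 \<le> norm (S n \<omega> - p)} \<union> {\<omega> \<in> space M. ennreal w < W n \<omega>}"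
        using D_nonneg[OF elim(2)] by (auto simp: not_less not_le) (metis not_le)
      then have "measure M {\<omega> \<in> space M. \<bar>D n \<omega>\<bar> > \<epsilon>}
          \<le> measure M ({\<omega> \<in> space M. \<delta> / 2 \<le> norm (S n \<omega> - p)} \<union> {\<omega> \<in> space M. ennreal w < W n \<omega>})"
        by (intro M.finite_measure_mono) auto
      also have "\<dots> \<le> measure M {\<omega> \<in> space M. \<delta> / 2 \<le> norm (S n \<omega> - p)} + measure M {\<omega> \<in> space M. ennreal w < W n \<omega>}"
        by (intro measure_Un_le) auto
      also have "\<dots> \<le> C\<^sup>2 / (real n * (\<delta> / 2)\<^sup>2) + 2 / (w * sqrt (real n))"
        using \<delta>(1) w(1) elim(2) by (intro add_mono S_prob W_prob) auto
      finally show ?case .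
    qed
    have lim: "(\<lambda>n. C\<^sup>2 / (real n * (\<delta> / 2)\<^sup>2) + 2 / (w * sqrt (real n))) \<longlonglongrightarrow> 0"
    proof -
      have "(\<lambda>n. C\<^sup>2 / (real n * (\<delta> / 2)\<^sup>2)) \<longlonglongrightarrow> 0"
        using lim_const_over_n[of "C\<^sup>2 / (\<delta> / 2)\<^sup>2"] by (simp add: divide_divide_eq_left mult.commute)
      moreover have "(\<lambda>n. (2 / w) / sqrt (real n)) \<longlonglongrightarrow> 0"
        by (rule real_tendsto_divide_at_top[OF tendsto_const filterlim_compose[OF sqrt_at_top filterlim_real_sequentially]])
      ultimately show ?thesis using tendsto_add by fastforce
    qed
    show ?thesis
      by (rule tendsto_sandwich[OF _ le tendsto_const lim]) simp
  qed
  with D_meas show ?thesis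
    unfolding bootstrap_consistent_def tendsto_zero_in_prob_def p D_def[symmetric] by blast
qed

subsection \<open>Quasi-means and centred moments\<close>

lemma borel_measurable_vec_lambda:
  fixes f :: "'i::finite \<Rightarrow> 'a \<Rightarrow> real"
  assumes "\<And>i. f i \<in> borel_measurable M"
  shows "(\<lambda>x. \<chi> i. f i x) \<in> borel_measurable M"
proof -
  have "(\<chi> i. f i x) = (\<Sum>i\<in>UNIV. f i x *\<^sub>R axis i (1::real))" for x
    by (simp add: vec_eq_iff axis_def if_distrib cong: if_cong)
  with assms show ?thesis by simp
qed

lemma strict_derivative_coord: "\<exists>L. strict_derivative (\<lambda>p. coord ord p j) L (p :: real ^ 'q::finite)"
proof (cases "j = 0")
  case True
  then show ?thesis using strict_derivative_const[of 1 p] by (auto simp: coord_def)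
next
  case False
  then show ?thesis
    using strict_derivative_bounded_linear[OF bounded_linear_vec_nth] by (auto simp: coord_def)
qed

lemma strict_derivative_centred_moments:
  fixes p :: "real ^ 'q::finite" and s :: "'m::finite \<Rightarrow> nat"
  shows "\<exists>L. strict_derivative (centred_moments ord s) L p"
proof -
  have "\<exists>L. strict_derivative (\<lambda>p :: real ^ 'q. c * (- coord ord p 1) ^ k * coord ord p j) L p" for c k j
  proof -
    obtain L1 where "strict_derivative (\<lambda>p :: real ^ 'q. coord ord p 1) L1 p"
      using strict_derivative_coord by blast
    from strict_derivative_compose_bounded_linear[OF this bounded_linear_minus[OF bounded_linear_ident]]
    obtain L2 where "strict_derivative (\<lambda>p :: real ^ 'q. (- coord ord p 1) ^ k) L2 p"
      using strict_derivative_power by blast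
    from strict_derivative_compose_bounded_linear[OF this bounded_linear_mult_right[of c]]
    obtain L3 where L3: "strict_derivative (\<lambda>p :: real ^ 'q. c * (- coord ord p 1) ^ k) L3 p"
      by blast
    obtain L4 where "strict_derivative (\<lambda>p :: real ^ 'q. coord ord p j) L4 p"
      using strict_derivative_coord by blast
    from strict_derivative_mult[OF L3 this] show ?thesis by (intro exI)
  qed
  then show ?thesis
    unfolding centred_moments_def[abs_def]
    by (intro strict_derivative_vec_lambda strict_derivative_sum) auto
qed

lemma borel_measurable_centred_moments:
  "centred_moments ord s \<in> borel_measurable (borel :: (real ^ 'q::finite) measure)"
proof -
  have [measurable]: "(\<lambda>p :: real ^ 'q. coord ord p j) \<in> borel_measurable borel" for j
    by (cases "j = 0") (auto simp: coord_def)
  show ?thesis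
    unfolding centred_moments_def[abs_def] by (intro borel_measurable_vec_lambda) measurable
qed

section \<open>The inverse of G and the quasi-means\<close>

context
  fixes I :: "real set" and G :: "real \<Rightarrow> real"
  assumes I: "is_interval I" and cont: "continuous_on I G" and mono: "strict_mono_on I G"
    and bij: "bij_betw G I {0<..<1}"
begin

lemma G_image: "G ` I = {0<..<1}" and G_inj: "inj_on G I"
  using bij by (simp_all add: bij_betw_def)

lemma inv_into_G: "y \<in> {0<..<1} \<Longrightarrow> inv_into I G y \<in> I" "y \<in> {0<..<1} \<Longrightarrow> G (inv_into I G y) = y"
  unfolding G_image[symmetric] by (rule inv_into_into f_inv_into_f; assumption)+

lemma inv_into_G_left: "x \<in> I \<Longrightarrow> inv_into I G (G x) = x"
  by (rule inv_into_f_f[OF G_inj])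

lemma G_range: "x \<in> I \<Longrightarrow> G x \<in> {0<..<1}"
  unfolding G_image[symmetric] by (rule imageI)

lemma inv_into_G_strict_mono:
  assumes "y \<in> {0<..<1}" "z \<in> {0<..<1}" "y < z"
  shows "inv_into I G y < inv_into I G z"
proof (rule ccontr)
  assume "\<not> ?thesis"
  then have "G (inv_into I G z) \<le> G (inv_into I G y)"
    using inv_into_G(1) assms mono by (intro strict_mono_on_leD[of I G]) auto
  then show False using assms inv_into_G(2) by simp
qed

text \<open>\<open>I\<close> has no endpoints of its own because the range of \<open>G\<close> is
  open: the values \<open>G c / 2\<close> and \<open>(G c + 1) / 2\<close> are attained on either
  side of \<open>c\<close>.\<close>

lemma interval_around:
  assumes "c \<in> I"
  obtains a b where "a < c" "c < b" "{a..b} \<subseteq> I"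
proof -
  have c: "0 < G c" "G c < 1" using G_range[OF assms] by auto
  define a b where "a = inv_into I G (G c / 2)" and "b = inv_into I G ((G c + 1) / 2)"
  have "a \<in> I" "b \<in> I" unfolding a_def b_def using c by (auto intro!: inv_into_G(1))
  moreover have "a < inv_into I G (G c)" "inv_into I G (G c) < b"
    unfolding a_def b_def using c by (auto intro!: inv_into_G_strict_mono)
  moreover have "{a..b} \<subseteq> I"
    using I \<open>a \<in> I\<close> \<open>b \<in> I\<close> unfolding is_interval_1 by (meson atLeastAtMost_iff subsetI)
  ultimately show thesis
    using that[of a b] unfolding inv_into_G_left[OF assms] by blast
qed

lemma isCont_G: "isCont G c" if "c \<in> I"
proof -
  obtain a b where "a < c" "c < b" "{a..b} \<subseteq> I" using interval_around[OF \<open>c \<in> I\<close>] .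
  then have "continuous_on {a<..<b} G"
    by (intro continuous_on_subset[OF cont] order_trans[OF greaterThanLessThan_subseteq_atLeastAtMost_iff[THEN iffD2]]) auto
  then show ?thesis
    using \<open>a < c\<close> \<open>c < b\<close> by (simp add: continuous_on_eq_continuous_at)
qed

lemma isCont_inv_into_G:
  assumes "y \<in> {0<..<1}"
  shows "isCont (inv_into I G) y"
proof -
  obtain a b where ab: "a < inv_into I G y" "inv_into I G y < b" "{a..b} \<subseteq> I"
    using interval_around[OF inv_into_G(1)[OF assms]] .
  have "isCont (inv_into I G) (G (inv_into I G y))"
  proof (rule isCont_inverse_function2[where a = a and b = b and f = G and g = "inv_into I G"])
    fix z assume "a \<le> z" "z \<le> b"
    with ab(3) have z: "z \<in> I" by auto
    show "inv_into I G (G z) = z" by (rule inv_into_G_left[OF z])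
    show "isCont G z" by (rule isCont_G[OF z])
  qed (use ab in auto)
  then show ?thesis using inv_into_G(2)[OF assms] by simp
qed

text \<open>Consistency includes measurability for every data sequence, and off \<open>I\<close> the
  transform is 0, so sample moments can leave (0, 1). The inverse must therefore be measurable on
  the whole line.\<close>

lemma borel_measurable_inv_into_G: "inv_into I G \<in> borel_measurable borel"
proof -
  \<comment> \<open>Outside the range no point qualifies as a preimage, so the choice predicate is
    identically false and \<open>inv_into\<close> takes one constant value.\<close>
  have eq: "inv_into I G y = (if y \<in> {0<..<1} then inv_into I G y else (SOME x. False))" for y
  proof -
    have "inv_into I G y = (SOME x. False)" if "y \<notin> {0<..<1}"
      unfolding inv_into_def using G_range that by (intro arg_cong[where f = Eps] ext) blast
    then show ?thesis by simp
  qed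
  have "continuous_on {0<..<1} (inv_into I G)"
    by (intro continuous_at_imp_continuous_on ballI isCont_inv_into_G)
  then have "(\<lambda>y. if y \<in> {0<..<1} then inv_into I G y else (SOME x. False)) \<in> borel_measurable borel"
    by (intro borel_measurable_continuous_on_if) auto
  then show ?thesis by (simp only: eq[symmetric])
qed

lemma borel_measurable_transform: "transform I G \<in> borel_measurable borel"
  unfolding transform_def[abs_def]
  using cont real_interval_borel_measurable[OF I] by (intro borel_measurable_continuous_on_if) auto

lemma transform_range: "transform I G x \<in> {0..1}"
  using G_range[of x] by (cases "x \<in> I") (auto simp: transform_def)

text \<open>Almost surely the transform is strictly between 0 and 1, and a strict inequality almost
  everywhere stays strict under a probability integral. This places the moments where the inverse of
  \<open>G\<close> is continuous; \<open>r = 0\<close> would give the endpoint 1.\<close>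

lemma moment_transform_in_01:
  assumes "prob_space P" "sets P = sets borel" "measure P I = 1" "0 < r"
  shows "moment P (transform I G) r \<in> {0<..<1}"
proof -
  interpret prob_space P by fact
  have [measurable]: "transform I G \<in> borel_measurable P"
    using borel_measurable_transform assms(2) by (simp cong: measurable_cong_sets)
  have int: "integrable P (\<lambda>x. transform I G x ^ r)"
    using transform_range by (intro integrable_bounded[where C = 1]) (auto intro: power_le_one)
  have "AE x in P. x \<in> I"
    using assms(2,3) real_interval_borel_measurable[OF I] by (subst AE_in_set_eq_1) auto
  then have AE: "AE x in P. 0 < transform I G x ^ r \<and> transform I G x ^ r < 1"
  proof eventually_elim
    case (elim x)
    then have "0 < transform I G x" "transform I G x < 1"
      using G_range by (auto simp: transform_def)
    then show ?case using \<open>0 < r\<close> by (simp add: power_less_one_iff)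
  qed
  have "(\<integral>x. 0 \<partial>P) < (\<integral>x. transform I G x ^ r \<partial>P)"
    using int AE by (intro integral_less_AE_space) (auto simp: emeasure_space_1)
  moreover have "(\<integral>x. transform I G x ^ r \<partial>P) < (\<integral>x. 1 \<partial>P)"
    using int AE by (intro integral_less_AE_space) (auto simp: emeasure_space_1)
  ultimately show ?thesis by (simp add: moment_def prob_space)
qed

text \<open>Each component is a coordinate projection followed by the inverse of \<open>G\<close>.
  Openness of (0, 1) gives the identity \<open>G (inv_into I G y) = y\<close> on a whole
  neighbourhood, as the inverse rule requires.\<close>

lemma strict_derivative_quasi_means:
  fixes p :: "real ^ 'q::finite"
  assumes "\<And>k. p $ k \<in> {0<..<1}"
    and "\<And>k. C1_near G (inv_into I G (p $ k))" "\<And>k. deriv G (inv_into I G (p $ k)) > 0"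
  shows "\<exists>L. strict_derivative (quasi_means I G) L p"
proof -
  have "\<exists>L. strict_derivative (\<lambda>p. inv_into I G (p $ k)) L p" for k
  proof -
    have "\<forall>\<^sub>F y in nhds (p $ k). y \<in> {0<..<1}"
      using assms(1) by (intro eventually_nhds_in_open) auto
    then have "\<forall>\<^sub>F y in nhds (p $ k). G (inv_into I G y) = y"
      by eventually_elim (rule inv_into_G(2))
    from strict_derivative_inverse[OF C1_near_imp_strict_derivative[OF assms(2)[of k]] assms(3)[of k]
        this isCont_inv_into_G[OF assms(1)]]
    have "strict_derivative (inv_into I G) (\<lambda>x. x / deriv G (inv_into I G (p $ k))) (p $ k)" .
    from strict_derivative_compose_right[OF this bounded_linear_vec_nth] show ?thesis by (intro exI)
  qed
  then show ?thesis
    unfolding quasi_means_def[abs_def] by (rule strict_derivative_vec_lambda)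
qed

lemma borel_measurable_quasi_means: "quasi_means I G \<in> borel_measurable (borel :: (real ^ 'q::finite) measure)"
proof -
  have "(\<lambda>p :: real ^ 'q. inv_into I G (p $ k)) \<in> borel_measurable borel" for k
    by (intro measurable_compose[OF _ borel_measurable_inv_into_G]) simp
  then show ?thesis
    unfolding quasi_means_def[abs_def] by (intro borel_measurable_vec_lambda)
qed

end

text \<open>The power of order r is r-Lipschitz on [0, 1], and the Euclidean norm is at most the sum
  of the absolute coordinates.\<close>

lemma norm_powers_diff_le:
  fixes ord :: "'q::finite \<Rightarrow> nat"
  assumes "x \<in> {0..1}" "y \<in> {0..1}"
  shows "norm ((\<chi> k. x ^ ord k) - (\<chi> k. y ^ ord k) :: real ^ 'q) \<le> (\<Sum>k\<in>UNIV. real (ord k)) * \<bar>x - y\<bar>"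
proof -
  have "norm ((\<chi> k. x ^ ord k) - (\<chi> k. y ^ ord k) :: real ^ 'q) \<le> (\<Sum>k\<in>UNIV. \<bar>x ^ ord k - y ^ ord k\<bar>)"
    using norm_le_l1_cart[of "(\<chi> k. x ^ ord k) - (\<chi> k. y ^ ord k) :: real ^ 'q"] by simp
  also have "\<dots> \<le> (\<Sum>k\<in>UNIV. real (ord k) * \<bar>x - y\<bar>)"
    using assms norm_power_diff[of x y] by (intro sum_mono) auto
  finally show ?thesis by (simp add: sum_distrib_right)
qed

theorem theorem6p6:
  fixes I :: "real set" and G :: "real \<Rightarrow> real"
    and M :: "'a measure" and X :: "nat \<Rightarrow> 'a \<Rightarrow> real" and P :: "real measure"
    and q :: nat and ord :: "'q::finite \<Rightarrow> nat"
  defines "U \<equiv> transform I G"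
  assumes "is_interval I"
    and "continuous_on I G" and "strict_mono_on I G" and "bij_betw G I {0<..<1}"
    and "prob_space M"
    and "prob_space.indep_vars M (\<lambda>_. borel) X UNIV"
    and "\<And>i. distr M borel (X i) = P"
    and "measure P I = 1"
    and "q \<ge> 1" and "bij_betw ord UNIV {1..q}"
  shows "bootstrap_consistent M X (sample_moments ord U) (moments ord P U)
    \<and> ((\<forall>r\<in>{1..q}. C1_near G (inv_into I G (moment P U r)) \<and>
                     deriv G (inv_into I G (moment P U r)) > 0) \<longrightarrow>
         bootstrap_consistent M X
           (\<lambda>n x. quasi_means I G (sample_moments ord U n x))
           (quasi_means I G (moments ord P U)))
    \<and> (\<forall>s :: 'm::finite \<Rightarrow> nat. (\<forall>i. 2 \<le> s i \<and> s i \<le> q) \<longrightarrow>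
         bootstrap_consistent M X
           (\<lambda>n x. centred_moments ord s (sample_moments ord U n x))
           (centred_moments ord s (moments ord P U)))"
proof -
  note G = assms(2-5)
  interpret M: prob_space M by fact
  have X: "X i \<in> borel_measurable M" for i
    using assms(7) by (simp add: M.indep_vars_def)
  have P: "prob_space P" "sets P = sets borel"
    unfolding assms(8)[of 0, symmetric] using M.prob_space_distr[OF X] by auto
  interpret P: prob_space P by (rule P)
  have U_meas[measurable]: "U \<in> borel_measurable borel"
    unfolding U_def by (rule borel_measurable_transform[OF G])
  have U01: "U x \<in> {0..1}" for x
    unfolding U_def by (rule transform_range[OF G])
  define g :: "real \<Rightarrow> real ^ 'q" where "g u = (\<chi> k. u ^ ord k)" for u
  have g_meas[measurable]: "g \<in> borel_measurable borel"
    unfolding g_def[abs_def] by (intro borel_measurable_vec_lambda) measurable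
  have sample: "sample_moments ord U n x = (\<Sum>i<n. g (U (x i))) /\<^sub>R n" for n x
    by (simp add: vec_eq_iff sample_moments_def sample_moment_def g_def divide_inverse mult.commute)
  have int_pow: "integrable P (\<lambda>x. U x ^ r)" for r
    using U01 U_meas P(2) by (intro P.integrable_bounded[where C = 1])
      (auto intro: power_le_one cong: measurable_cong_sets)
  have mean: "moments ord P U = (\<integral>x. g (U x) \<partial>P)"
  proof -
    \<comment> \<open>Expanding along the axis vectors reduces the vector-valued integral to scalar
      moments.\<close>
    have eq: "g (U x) = (\<Sum>k\<in>UNIV. U x ^ ord k *\<^sub>R axis k (1::real))" for x
      by (simp add: g_def vec_eq_iff axis_def if_distrib cong: if_cong)
    have "(\<integral>x. g (U x) \<partial>P) = (\<Sum>k\<in>UNIV. moment P U (ord k) *\<^sub>R axis k (1::real))"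
      unfolding eq using int_pow by (simp add: moment_def)
    also have "\<dots> = moments ord P U"
      by (simp add: moments_def vec_eq_iff axis_def if_distrib cong: if_cong)
    finally show ?thesis ..
  qed
  have main: "bootstrap_consistent M X (\<lambda>n x. \<phi> (sample_moments ord U n x)) (\<phi> (moments ord P U))"
    if "\<phi> \<in> borel_measurable borel" "\<exists>L. strict_derivative \<phi> L (moments ord P U)"
    for \<phi> :: "real ^ 'q \<Rightarrow> real ^ 'k::finite"
  proof -
    from that(2) obtain L where "strict_derivative \<phi> L (\<integral>x. g (U x) \<partial>P)"
      unfolding mean by blast
    then show ?thesis
      unfolding sample mean
      using norm_powers_diff_le[of _ _ ord, folded g_def]
      by (intro bootstrap_consistent_strict_derivative assms U_meas U01 g_meas that(1))
  qed
  show ?thesis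
  proof (intro conjI impI allI)
    show "bootstrap_consistent M X (sample_moments ord U) (moments ord P U)"
      using main[of "\<lambda>x. x"] strict_derivative_bounded_linear[OF bounded_linear_ident] by auto
  next
    assume C1: "\<forall>r\<in>{1..q}. C1_near G (inv_into I G (moment P U r)) \<and>
                     deriv G (inv_into I G (moment P U r)) > 0"
    have ord: "ord k \<in> {1..q}" for k using assms(11) by (auto simp: bij_betw_def)
    \<comment> \<open>The numbering starts at 1, so the zeroth power, whose moment is the endpoint
      1, does not occur.\<close>
    then have pos: "0 < ord k" for k by (simp add: Suc_le_lessD)
    have "moments ord P U $ k \<in> {0<..<1}" for k
      using moment_transform_in_01[OF G P assms(9) pos] by (simp add: moments_def U_def)
    moreover have "C1_near G (inv_into I G (moments ord P U $ k))"
        "deriv G (inv_into I G (moments ord P U $ k)) > 0" for k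
      using C1 ord by (auto simp: moments_def)
    ultimately show "bootstrap_consistent M X (\<lambda>n x. quasi_means I G (sample_moments ord U n x))
        (quasi_means I G (moments ord P U))"
      by (intro main[of "quasi_means I G"] borel_measurable_quasi_means[OF G] strict_derivative_quasi_means[OF G])
  next
    fix s :: "'m \<Rightarrow> nat"
    show "bootstrap_consistent M X (\<lambda>n x. centred_moments ord s (sample_moments ord U n x))
        (centred_moments ord s (moments ord P U))"
      by (intro main[of "centred_moments ord s"] borel_measurable_centred_moments strict_derivative_centred_moments)
  qed
qed

end
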